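(* (Moderate coupling.) Let $(a_e(z),a_o(z))_{z\ge0}$ be the $\mathbb C^2$-valued Markov process with initial condition $(a_e^{(0)},a_o^{(0)})\neq(0,0)$ and infinitesimal generator $$\begin{aligned}\mathcal L=&\ \Gamma\big(|a_e|^2\partial_{a_o}\partial_{\overline{a_o}}+|a_o|^2\partial_{a_e}\partial_{\overline{a_e}}-a_ea_o\partial_{a_e}\partial_{a_o}-\overline{a_e}\,\overline{a_o}\,\partial_{\overline{a_e}}\partial_{\overline{a_o}}\big)\\&+\frac\Gamma2\sum_{t,t'\in\{e,o\}}\big(a_t\overline{a_{t'}}\partial_{a_t}\partial_{\overline{a_{t'}}}+\overline{a_t}a_{t'}\partial_{\overline{a_t}}\partial_{a_{t'}}-a_ta_{t'}\partial_{a_t}\partial_{a_{t'}}-\overline{a_t}\,\overline{a_{t'}}\,\partial_{\overline{a_t}}\partial_{\overline{a_{t'}}}\big)-\Gamma\sum_{t\in\{e,o\}}\big(a_t\partial_{a_t}+\overline{a_t}\partial_{\overline{a_t}}\big)\\&-\frac12\sum_{t\in\{e,o\}}\big[(\Lambda+i\Theta)a_t\partial_{a_t}+(\Lambda-i\Theta)\overline{a_t}\partial_{\overline{a_t}}\big]+i(\kappa+\kappa^{\rm ev})\sum_{t\in\{e,o\}}\big(a_t\partial_{a_t}-\overline{a_t}\partial_{\overline{a_t}}\big).\end{aligned}$$ For $\varepsilon>0$ and the wavenumbers $\beta_e,\beta_o,\beta$ of the context, let $u_\pm(z)=a_e(z)e^{i(\beta_e-\beta)z/\varepsilon^2}\pm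 a_o(z)e^{i(\beta_o-\beta)z/\varepsilon^2}$ and $\mathcal P(z)=\dfrac{|u_+(z)|^2-|u_-(z)|^2}{|u_+(z)|^2+|u_-(z)|^2}$. Then, for all $z\ge0$: (i) with probability one, $|a_e(z)|^2+|a_o(z)|^2=\big(|a_e^{(0)}|^2+|a_o^{(0)}|^2\big)e^{-\Lambda z}$, and consequently $|u_+(z)|^2+|u_-(z)|^2=2\big(|a_e(z)|^2+|a_o(z)|^2\big)=2\big(|a_e^{(0)}|^2+|a_o^{(0)}|^2\big)e^{-\Lambda z}$; (ii) $\mathbb E\big[a_o(z)\overline{a_e(z)}\big]=a_o^{(0)}\overline{a_e^{(0)}}\,e^{-(\Gamma+\Lambda)z}$; (iii) $$\mathbb E[\mathcal P(z)]=\frac{2\,\mathrm{Re}\big\{a_e^{(0)}\overline{a_o^{(0)}}\exp\big(i(\beta_e-\beta_o)\frac z{\varepsilon^2}\big)\big\}}{|a_e^{(0)}|^2+|a_o^{(0)}|^2}\,e^{-\Gamma z}.$$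
   Context: Complex derivatives: for $\zeta=\zeta_r+i\zeta_i$, $\partial_\zeta=\frac12(\partial_{\zeta_r}-i\partial_{\zeta_i})$, $\partial_{\overline\zeta}=\frac12(\partial_{\zeta_r}+i\partial_{\zeta_i})$; the generator acts on functions of $(a_e,\overline{a_e},a_o,\overline{a_o})$. The process is the $\varepsilon\to0$ limit of the even and odd guided mode amplitudes in a system of two randomly perturbed single-mode step-index waveguides (width $D$, index of refraction $n>1$, separation $d$ with $1\gg e^{-\eta d}\gg\varepsilon^2$) at wavenumber $k$, with $kD\sqrt{n^2-1}<\pi$. Here $\beta$ is the unique solution in $(k,nk)$ of $\frac{\sqrt{n^2k^2-\beta^2}}{\sqrt{\beta^2-k^2}}\tan(\frac D2\sqrt{n^2k^2-\beta^2})=1$, $\xi=\sqrt{n^2k^2-\beta^2}$, $\eta=\sqrt{\beta^2-k^2}$, and $\beta_e,\beta_o$ are the wavenumbers of the even and odd guided modes of the two-waveguide system, i.e. $\beta_e^2,\beta_o^2$ are the eigenvalues in $(k^2,n^2k^2)$ of $\partial_x^2+k^2({\rm n}^{(0)}(x))^2$ with even and odd eigenfunction, with ${\rm n}^{(0)}=n$ on $(-d/2-D,-d/2)\cup(d/2,d/2+D)$ and $1$ elsewhere. The real coefficients ($\Gamma,\Lambda\ge0$) are as follows. Let $\mathcal R$ be the smooth, integrable covariance function of the stationary interface fluctuations and $\widehat{\mathcal R}(\kappa)=\int_{-\infty}^\infty\mathcal R(z)e^{i\kappa z}dz\ge0$; $\xi_\gamma=\sqrt{k^2n^2-\gamma}$,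 $\eta_\gamma=\sqrt{k^2-\gamma}$, $G(\gamma)=\dfrac{2\frac{\xi_\gamma^2}{\eta_\gamma^2}+\sin^2(\xi_\gamma D)(1-\frac{\xi_\gamma^2}{\eta_\gamma^2})}{4\frac{\xi_\gamma^2}{\eta_\gamma^2}+\sin^2(\xi_\gamma D)(1-\frac{\xi_\gamma^2}{\eta_\gamma^2})^2}$, $M=\dfrac{k^4(n^2-1)^2D^2}{\beta(\frac2\eta+D)}\cos^2(\frac{\xi D}2)$. Then $$\Gamma=\frac{k^4(n^2-1)^2D^2}{\beta^2(\frac2\eta+D)^2}\cos^4\Big(\frac{\xi D}2\Big)\widehat{\mathcal R}(0),\quad \Lambda=\frac M2\int_0^{k^2}\frac{G(\gamma)}{\pi\eta_\gamma\sqrt\gamma}\widehat{\mathcal R}(\beta-\sqrt\gamma)d\gamma,\quad \Theta=M\int_0^{k^2}\frac{G(\gamma)}{\pi\eta_\gamma\sqrt\gamma}\int_0^\infty\mathcal R(z)\sin[(\sqrt\gamma-\beta)z]dz\,d\gamma,$$ $$\kappa^{\rm ev}=M\int_{-\infty}^0\frac{G(\gamma)}{\pi\eta_\gamma\sqrt{|\gamma|}}\int_0^\infty\mathcal R(z)\cos(\beta z)e^{-\sqrt{|\gamma|}z}dz\,d\gamma,\quad \kappa=-\frac{k^2(n^2-1)D^2\xi}{\beta(\frac2\eta+D)}\mathcal R(0)\sin(\xi D).$$ *)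

theory Defs
  imports "HOL-Probability.Probability"
begin

subsection \<open>Functions on \<open>\<complex>\<^sup>2\<close> and the operator \<open>\<L>\<close>\<close>

datatype mode = Even | Odd

type_synonym amplitudes = "complex \<times> complex"

fun amp :: "mode \<Rightarrow> amplitudes \<Rightarrow> complex" where
  "amp Even a = fst a"
| "amp Odd a = snd a"

fun axis_vec :: "mode \<Rightarrow> complex \<Rightarrow> amplitudes" where
  "axis_vec Even w = (w, 0)"
| "axis_vec Odd w = (0, w)"

definition partial_deriv :: "'a::real_normed_vector \<Rightarrow> ('a \<Rightarrow> complex) \<Rightarrow> 'a \<Rightarrow> complex" where
  "partial_deriv v f x = vector_derivative (\<lambda>t::real. f (x + t *\<^sub>R v)) (at 0)"

text \<open>Over the reals, the standard basis of \<open>amplitudes\<close> consists of the four vectors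
  \<open>(1,0)\<close>, \<open>(\<i>,0)\<close>, \<open>(0,1)\<close>, \<open>(0,\<i>)\<close>.\<close>

definition C1_fun :: "('a::euclidean_space \<Rightarrow> complex) \<Rightarrow> bool" where
  "C1_fun f \<longleftrightarrow> (\<forall>v\<in>Basis.
     (\<forall>x. (\<lambda>t::real. f (x + t *\<^sub>R v)) differentiable (at 0)) \<and>
     continuous_on UNIV (partial_deriv v f))"

definition C2_fun :: "('a::euclidean_space \<Rightarrow> complex) \<Rightarrow> bool" where
  "C2_fun f \<longleftrightarrow> C1_fun f \<and> (\<forall>v\<in>Basis. C1_fun (partial_deriv v f))"

definition C2c :: "('a::euclidean_space \<Rightarrow> complex) set" where
  "C2c = {f. C2_fun f \<and> (\<exists>K. compact K \<and> (\<forall>x. x \<notin> K \<longrightarrow> f x = 0))}"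

definition wirt :: "mode \<Rightarrow> (amplitudes \<Rightarrow> complex) \<Rightarrow> amplitudes \<Rightarrow> complex" where
  "wirt t f a = 1/2 * (partial_deriv (axis_vec t 1) f a - \<i> * partial_deriv (axis_vec t \<i>) f a)"

definition wirt_bar :: "mode \<Rightarrow> (amplitudes \<Rightarrow> complex) \<Rightarrow> amplitudes \<Rightarrow> complex" where
  "wirt_bar t f a = 1/2 * (partial_deriv (axis_vec t 1) f a + \<i> * partial_deriv (axis_vec t \<i>) f a)"

text \<open>The parameter \<open>\<nu>\<close> stands for \<open>\<kappa> + \<kappa>\<^sup>e\<^sup>v\<close>.\<close>

definition coupler_gen ::
    "real \<Rightarrow> real \<Rightarrow> real \<Rightarrow> real \<Rightarrow> (amplitudes \<Rightarrow> complex) \<Rightarrow> amplitudes \<Rightarrow> complex" where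
  "coupler_gen \<Gamma> \<Lambda> \<Theta> \<nu> f a =
     of_real \<Gamma> *
       ( of_real ((cmod (amp Even a))\<^sup>2) * wirt Odd (wirt_bar Odd f) a
       + of_real ((cmod (amp Odd a))\<^sup>2) * wirt Even (wirt_bar Even f) a
       - amp Even a * amp Odd a * wirt Even (wirt Odd f) a
       - cnj (amp Even a) * cnj (amp Odd a) * wirt_bar Even (wirt_bar Odd f) a)
   + of_real (\<Gamma> / 2) * (\<Sum>t\<in>{Even, Odd}. \<Sum>t'\<in>{Even, Odd}.
         amp t a * cnj (amp t' a) * wirt t (wirt_bar t' f) a
       + cnj (amp t a) * amp t' a * wirt_bar t (wirt t' f) a
       - amp t a * amp t' a * wirt t (wirt t' f) a
       - cnj (amp t a) * cnj (amp t' a) * wirt_bar t (wirt_bar t' f) a)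
   - of_real \<Gamma> * (\<Sum>t\<in>{Even, Odd}. amp t a * wirt t f a + cnj (amp t a) * wirt_bar t f a)
   - 1/2 * (\<Sum>t\<in>{Even, Odd}.
         (of_real \<Lambda> + \<i> * of_real \<Theta>) * amp t a * wirt t f a
       + (of_real \<Lambda> - \<i> * of_real \<Theta>) * cnj (amp t a) * wirt_bar t f a)
   + \<i> * of_real \<nu> * (\<Sum>t\<in>{Even, Odd}. amp t a * wirt t f a - cnj (amp t a) * wirt_bar t f a)"

subsection \<open>Markov processes and their infinitesimal generators\<close>

definition markov_semigroup :: "(real \<Rightarrow> 'a::topological_space \<Rightarrow> 'a measure) \<Rightarrow> bool" where
  "markov_semigroup P \<longleftrightarrow>
     (\<forall>t\<ge>0. P t \<in> borel \<rightarrow>\<^sub>M prob_algebra borel) \<and>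
     (\<forall>x. P 0 x = return borel x) \<and>
     (\<forall>s\<ge>0. \<forall>t\<ge>0. \<forall>x. P (s + t) x = P s x \<bind> P t)"

text \<open>\<open>(f, g)\<close> belongs to the (strong) infinitesimal generator of the semigroup
  \<open>P\<^sub>t f(x) = \<integral> f dP\<^sub>t(x, \<cdot>)\<close> on bounded Borel functions with the supremum norm.\<close>

definition inf_generator ::
    "(real \<Rightarrow> 'a::topological_space \<Rightarrow> 'a measure) \<Rightarrow> (('a \<Rightarrow> complex) \<times> ('a \<Rightarrow> complex)) set" where
  "inf_generator P = {(f, g).
     f \<in> borel_measurable borel \<and> bounded (range f) \<and>
     g \<in> borel_measurable borel \<and> bounded (range g) \<and>
     uniform_limit UNIV (\<lambda>t x. ((\<integral>y. f y \<partial>P t x) - f x) / of_real t) g (at_right 0)}"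

definition natural_filtration :: "'w measure \<Rightarrow> (real \<Rightarrow> 'w \<Rightarrow> 'a::topological_space) \<Rightarrow> real \<Rightarrow> 'w measure" where
  "natural_filtration M X s =
     sigma (space M) {X u -` A \<inter> space M | u A. 0 \<le> u \<and> u \<le> s \<and> A \<in> sets borel}"

definition markov_process ::
    "'w measure \<Rightarrow> (real \<Rightarrow> 'w \<Rightarrow> 'a::topological_space) \<Rightarrow> (real \<Rightarrow> 'a \<Rightarrow> 'a measure) \<Rightarrow> bool" where
  "markov_process M X P \<longleftrightarrow>
     prob_space M \<and> markov_semigroup P \<and> (\<forall>t\<ge>0. X t \<in> M \<rightarrow>\<^sub>M borel) \<and>
     (\<forall>s\<ge>0. \<forall>t\<ge>0. \<forall>A\<in>sets borel. AE \<omega> in M.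
        real_cond_exp M (natural_filtration M X s) (\<lambda>\<omega>. indicator A (X (s + t) \<omega>)) \<omega>
          = measure (P t (X s \<omega>)) A)"

text \<open>A diffusion operator \<open>A\<close> is the infinitesimal generator of a process if the generator of
  the transition semigroup is defined on the twice continuously differentiable functions with
  compact support and coincides with \<open>A\<close> there.\<close>

definition markov_process_generated_by ::
    "'w measure \<Rightarrow> (real \<Rightarrow> 'w \<Rightarrow> 'a::euclidean_space) \<Rightarrow>
     (('a \<Rightarrow> complex) \<Rightarrow> 'a \<Rightarrow> complex) \<Rightarrow> 'a \<Rightarrow> bool" where
  "markov_process_generated_by M X A x0 \<longleftrightarrow>
     (\<exists>P. markov_process M X P \<and> (\<forall>f\<in>C2c. (f, A f) \<in> inf_generator P)) \<and>
     (AE \<omega> in M. X 0 \<omega> = x0)"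

subsection \<open>The waveguides\<close>

definition xi :: "real \<Rightarrow> real \<Rightarrow> real \<Rightarrow> real" where
  "xi k n \<beta> = sqrt (n\<^sup>2 * k\<^sup>2 - \<beta>\<^sup>2)"

definition eta :: "real \<Rightarrow> real \<Rightarrow> real" where
  "eta k \<beta> = sqrt (\<beta>\<^sup>2 - k\<^sup>2)"

definition single_guide_wavenumber :: "real \<Rightarrow> real \<Rightarrow> real \<Rightarrow> real \<Rightarrow> bool" where
  "single_guide_wavenumber k n D \<beta> \<longleftrightarrow>
     k < \<beta> \<and> \<beta> < n * k \<and> xi k n \<beta> / eta k \<beta> * tan (D / 2 * xi k n \<beta>) = 1"

definition index_profile :: "real \<Rightarrow> real \<Rightarrow> real \<Rightarrow> real \<Rightarrow> real" where
  "index_profile n d D x =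
     (if x \<in> {-d/2 - D <..< -d/2} \<union> {d/2 <..< d/2 + D} then n else 1)"

definition square_integrable :: "(real \<Rightarrow> complex) \<Rightarrow> bool" where
  "square_integrable \<phi> \<longleftrightarrow>
     \<phi> \<in> borel_measurable lborel \<and> integrable lborel (\<lambda>x. (cmod (\<phi> x))\<^sup>2)"

text \<open>\<open>\<phi>\<close> is the \<open>C\<^sup>1\<close> representative of an element of the Sobolev space \<open>H\<^sup>2(\<real>)\<close> with weak
  derivatives \<open>\<phi>'\<close> and \<open>\<phi>''\<close>.\<close>

definition in_H2 :: "(real \<Rightarrow> complex) \<Rightarrow> (real \<Rightarrow> complex) \<Rightarrow> (real \<Rightarrow> complex) \<Rightarrow> bool" where
  "in_H2 \<phi> \<phi>' \<phi>'' \<longleftrightarrow>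
     square_integrable \<phi> \<and> square_integrable \<phi>' \<and> square_integrable \<phi>'' \<and>
     (\<forall>a b. a \<le> b \<longrightarrow> \<phi> b - \<phi> a = (LBINT x:{a..b}. \<phi>' x)) \<and>
     (\<forall>a b. a \<le> b \<longrightarrow> \<phi>' b - \<phi>' a = (LBINT x:{a..b}. \<phi>'' x))"

definition eigenfunction :: "real \<Rightarrow> (real \<Rightarrow> real) \<Rightarrow> real \<Rightarrow> (real \<Rightarrow> complex) \<Rightarrow> bool" where
  "eigenfunction k N \<mu> \<phi> \<longleftrightarrow> (\<exists>x. \<phi> x \<noteq> 0) \<and>
     (\<exists>\<phi>' \<phi>''. in_H2 \<phi> \<phi>' \<phi>'' \<and>
        (AE x in lborel. \<phi>'' x + of_real (k\<^sup>2 * (N x)\<^sup>2) * \<phi> x = of_real \<mu> * \<phi> x))"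

definition even_wavenumber :: "real \<Rightarrow> real \<Rightarrow> real \<Rightarrow> real \<Rightarrow> real \<Rightarrow> bool" where
  "even_wavenumber k n d D b \<longleftrightarrow> 0 < b \<and> k\<^sup>2 < b\<^sup>2 \<and> b\<^sup>2 < n\<^sup>2 * k\<^sup>2 \<and>
     (\<exists>\<phi>. eigenfunction k (index_profile n d D) (b\<^sup>2) \<phi> \<and> (\<forall>x. \<phi> (-x) = \<phi> x))"

definition odd_wavenumber :: "real \<Rightarrow> real \<Rightarrow> real \<Rightarrow> real \<Rightarrow> real \<Rightarrow> bool" where
  "odd_wavenumber k n d D b \<longleftrightarrow> 0 < b \<and> k\<^sup>2 < b\<^sup>2 \<and> b\<^sup>2 < n\<^sup>2 * k\<^sup>2 \<and>
     (\<exists>\<phi>. eigenfunction k (index_profile n d D) (b\<^sup>2) \<phi> \<and> (\<forall>x. \<phi> (-x) = - \<phi> x))"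

subsection \<open>The interface fluctuations\<close>

text \<open>Only second-order stationarity is demanded.\<close>

definition stationary_with_covariance ::
    "'v measure \<Rightarrow> (real \<Rightarrow> 'v \<Rightarrow> real) \<Rightarrow> (real \<Rightarrow> real) \<Rightarrow> bool" where
  "stationary_with_covariance N V R \<longleftrightarrow>
     prob_space N \<and>
     (\<forall>z. V z \<in> borel_measurable N \<and> integrable N (\<lambda>\<omega>. (V z \<omega>)\<^sup>2)) \<and>
     (\<exists>m. (\<forall>z. (\<integral>\<omega>. V z \<omega> \<partial>N) = m) \<and>
          (\<forall>z z'. (\<integral>\<omega>. (V z \<omega> - m) * (V z' \<omega> - m) \<partial>N) = R (z - z')))"

definition smooth_fun :: "(real \<Rightarrow> real) \<Rightarrow> bool" where
  "smooth_fun R \<longleftrightarrow> (\<forall>j x. (deriv ^^ j) R differentiable (at x))"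

text \<open>A covariance function is even, so its Fourier transform is real and taking the real part
  loses nothing.\<close>

definition spectrum :: "(real \<Rightarrow> real) \<Rightarrow> real \<Rightarrow> real" where
  "spectrum R \<kappa> = Re (LBINT z. of_real (R z) * exp (\<i> * of_real (\<kappa> * z)))"

subsection \<open>The effective coefficients\<close>

definition xi_rad :: "real \<Rightarrow> real \<Rightarrow> real \<Rightarrow> real" where
  "xi_rad k n \<gamma> = sqrt (k\<^sup>2 * n\<^sup>2 - \<gamma>)"

definition eta_rad :: "real \<Rightarrow> real \<Rightarrow> real" where
  "eta_rad k \<gamma> = sqrt (k\<^sup>2 - \<gamma>)"

definition G_fun :: "real \<Rightarrow> real \<Rightarrow> real \<Rightarrow> real \<Rightarrow> real" where
  "G_fun k n D \<gamma> =
     (let q = (xi_rad k n \<gamma>)\<^sup>2 / (eta_rad k \<gamma>)\<^sup>2; s = (sin (xi_rad k n \<gamma> * D))\<^sup>2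
      in (2 * q + s * (1 - q)) / (4 * q + s * (1 - q)\<^sup>2))"

definition M_coef :: "real \<Rightarrow> real \<Rightarrow> real \<Rightarrow> real \<Rightarrow> real" where
  "M_coef k n D \<beta> =
     k^4 * (n\<^sup>2 - 1)\<^sup>2 * D\<^sup>2 / (\<beta> * (2 / eta k \<beta> + D)) * (cos (xi k n \<beta> * D / 2))\<^sup>2"

definition Gamma_coef :: "real \<Rightarrow> real \<Rightarrow> real \<Rightarrow> real \<Rightarrow> (real \<Rightarrow> real) \<Rightarrow> real" where
  "Gamma_coef k n D \<beta> R =
     k^4 * (n\<^sup>2 - 1)\<^sup>2 * D\<^sup>2 / (\<beta>\<^sup>2 * (2 / eta k \<beta> + D)\<^sup>2) * (cos (xi k n \<beta> * D / 2))^4 * spectrum R 0"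

definition Lambda_coef :: "real \<Rightarrow> real \<Rightarrow> real \<Rightarrow> real \<Rightarrow> (real \<Rightarrow> real) \<Rightarrow> real" where
  "Lambda_coef k n D \<beta> R = M_coef k n D \<beta> / 2 *
     (LBINT \<gamma>:{0..k\<^sup>2}. G_fun k n D \<gamma> / (pi * eta_rad k \<gamma> * sqrt \<gamma>) * spectrum R (\<beta> - sqrt \<gamma>))"

definition Theta_coef :: "real \<Rightarrow> real \<Rightarrow> real \<Rightarrow> real \<Rightarrow> (real \<Rightarrow> real) \<Rightarrow> real" where
  "Theta_coef k n D \<beta> R = M_coef k n D \<beta> *
     (LBINT \<gamma>:{0..k\<^sup>2}. G_fun k n D \<gamma> / (pi * eta_rad k \<gamma> * sqrt \<gamma>) *
        (LBINT z:{0..}. R z * sin ((sqrt \<gamma> - \<beta>) * z)))"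

definition kappa_ev :: "real \<Rightarrow> real \<Rightarrow> real \<Rightarrow> real \<Rightarrow> (real \<Rightarrow> real) \<Rightarrow> real" where
  "kappa_ev k n D \<beta> R = M_coef k n D \<beta> *
     (LBINT \<gamma>:{..0}. G_fun k n D \<gamma> / (pi * eta_rad k \<gamma> * sqrt \<bar>\<gamma>\<bar>) *
        (LBINT z:{0..}. R z * cos (\<beta> * z) * exp (- sqrt \<bar>\<gamma>\<bar> * z)))"

definition kappa_coef :: "real \<Rightarrow> real \<Rightarrow> real \<Rightarrow> real \<Rightarrow> (real \<Rightarrow> real) \<Rightarrow> real" where
  "kappa_coef k n D \<beta> R =
     - (k\<^sup>2 * (n\<^sup>2 - 1) * D\<^sup>2 * xi k n \<beta> / (\<beta> * (2 / eta k \<beta> + D))) * R 0 * sin (xi k n \<beta> * D)"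

subsection \<open>Amplitudes in the individual waveguides\<close>

definition u_plus :: "real \<Rightarrow> real \<Rightarrow> real \<Rightarrow> real \<Rightarrow> real \<Rightarrow> amplitudes \<Rightarrow> complex" where
  "u_plus \<beta>e \<beta>o \<beta> \<epsilon> z a =
     amp Even a * exp (\<i> * of_real ((\<beta>e - \<beta>) * z / \<epsilon>\<^sup>2)) +
     amp Odd a * exp (\<i> * of_real ((\<beta>o - \<beta>) * z / \<epsilon>\<^sup>2))"

definition u_minus :: "real \<Rightarrow> real \<Rightarrow> real \<Rightarrow> real \<Rightarrow> real \<Rightarrow> amplitudes \<Rightarrow> complex" where
  "u_minus \<beta>e \<beta>o \<beta> \<epsilon> z a =
     amp Even a * exp (\<i> * of_real ((\<beta>e - \<beta>) * z / \<epsilon>\<^sup>2)) -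
     amp Odd a * exp (\<i> * of_real ((\<beta>o - \<beta>) * z / \<epsilon>\<^sup>2))"

definition power_imbalance :: "real \<Rightarrow> real \<Rightarrow> real \<Rightarrow> real \<Rightarrow> real \<Rightarrow> amplitudes \<Rightarrow> real" where
  "power_imbalance \<beta>e \<beta>o \<beta> \<epsilon> z a =
     ((cmod (u_plus \<beta>e \<beta>o \<beta> \<epsilon> z a))\<^sup>2 - (cmod (u_minus \<beta>e \<beta>o \<beta> \<epsilon> z a))\<^sup>2) /
     ((cmod (u_plus \<beta>e \<beta>o \<beta> \<epsilon> z a))\<^sup>2 + (cmod (u_minus \<beta>e \<beta>o \<beta> \<epsilon> z a))\<^sup>2)"

end

theory Submission
  imports Defs
begin

text \<open>
Write \<open>r = \<bar>a\<^sub>e\<bar>\<^sup>2 + \<bar>a\<^sub>o\<bar>\<^sup>2\<close>. The terms of the generator that carry \<open>\<Gamma>\<close> act tangentially to the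
spheres \<open>r = const\<close>, the terms in \<open>\<Theta>\<close> and \<open>\<nu>\<close> only rotate the common phase, and \<open>\<Lambda>\<close> contributes
the radial drift \<open>- \<Lambda> r \<partial>\<^sub>r\<close>. The coherence \<open>q = a\<^sub>o cnj a\<^sub>e\<close> does not see the common phase and is an
eigenfunction for the eigenvalue \<open>- (\<Gamma> + \<Lambda>)\<close>. Both facts are contained in one identity for
\<open>(c + c' q) K(r)\<close>, which lemma \<open>coupler_gen_coherence\<close> verifies by Wirtinger calculus.

The generator is only known on \<open>C\<^sup>2\<close> functions of compact support, so \<open>r\<close> and \<open>q\<close> themselves are not
admissible. With a cut-off \<open>K\<close> of compact support the functions
\<open>F\<^sub>s = (c + c' exp (- (\<Gamma> + \<Lambda>) s) q) K(exp (- \<Lambda> s) r)\<close> are admissible, and they solve the backward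
equation \<open>\<partial>\<^sub>s F\<^sub>s = \<L> F\<^sub>s\<close> uniformly in space. Lemma \<open>backward_equation_solution\<close> then gives
\<open>P\<^sub>t F\<^sub>0 = F\<^sub>t\<close>, which is lemma \<open>transition_integral_coherence\<close>.

Now fix a starting point \<open>x\<close> and a time \<open>t\<close>, and let \<open>K\<close> be a bump with values in \<open>[0, 1]\<close> that equals 1
only at \<open>m = exp (- \<Lambda> t) r(x)\<close>. For \<open>c = 1\<close>, \<open>c' = 0\<close> the integral of \<open>K(r)\<close> against \<open>P\<^sub>t(x, \<cdot>)\<close> is
\<open>K(m) = 1\<close>, which forces \<open>r = m\<close> almost surely: this is the law of the total power. Consequently the
cut-off is invisible to \<open>P\<^sub>t(x, \<cdot>)\<close>, and \<open>c = 0\<close>, \<open>c' = 1\<close> gives the mean of \<open>q\<close>. Finally, the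
denominator of the power imbalance is \<open>2 r\<close>, hence deterministic, while its numerator is a real linear
function of \<open>q\<close>; so the mean imbalance follows from the mean coherence.
\<close>

section \<open>Transition semigroups and the backward equation\<close>

text \<open>
Only one-sided information is available for \<open>s \<mapsto> P\<^sub>t\<^sub>-\<^sub>s F\<^sub>s\<close>, because the generator is a limit at
\<open>0\<close> from the right. For every slope \<open>e > 0\<close> the set of times at which \<open>\<parallel>w s - w 0\<parallel> > e s\<close> is empty: its
infimum cannot belong to it by left continuity, and cannot lie outside it by the right derivative.
\<close>

lemma right_derivative_zero_imp_const:
  fixes w :: "real \<Rightarrow> 'b::real_normed_vector"
  assumes "t \<ge> 0"
    and left: "\<And>s e. 0 < s \<Longrightarrow> s \<le> t \<Longrightarrow> e > 0 \<Longrightarrow>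
      \<exists>d>0. \<forall>h. 0 < h \<and> h < d \<and> h \<le> s \<longrightarrow> norm (w s - w (s - h)) \<le> e"
    and right: "\<And>s e. 0 \<le> s \<Longrightarrow> s < t \<Longrightarrow> e > 0 \<Longrightarrow>
      \<exists>d>0. \<forall>h. 0 < h \<and> h < d \<and> s + h \<le> t \<longrightarrow> norm (w (s + h) - w s) \<le> e * h"
  shows "w t = w 0"
proof -
  have bound: "norm (w t - w 0) \<le> e * t" if "e > 0" for e
  proof (rule ccontr)
    assume "\<not> norm (w t - w 0) \<le> e * t"
    define S where "S = {s\<in>{0..t}. norm (w s - w 0) > e * s}"
    have "t \<in> S" using \<open>\<not> _\<close> \<open>t \<ge> 0\<close> by (auto simp: S_def)
    have bdd: "bdd_below S" unfolding S_def by (rule bdd_belowI[of _ 0]) auto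
    define c where "c = Inf S"
    have c0: "0 \<le> c" unfolding c_def using \<open>t \<in> S\<close>
      by (intro cInf_greatest) (auto simp: S_def)
    have ct: "c \<le> t" unfolding c_def using \<open>t \<in> S\<close> bdd by (rule cInf_lower)
    have below: "s \<notin> S" if "s < c" for s
      using that bdd cInf_lower[of s S] by (auto simp: c_def)
    have "c \<notin> S"
    proof
      assume "c \<in> S"
      define g where "g = (norm (w c - w 0) - e * c) / 2"
      have "g > 0" using \<open>c \<in> S\<close> by (simp add: S_def g_def)
      have "c > 0" using \<open>c \<in> S\<close> c0 by (cases "c = 0") (auto simp: S_def)
      obtain d where d: "d > 0" "\<And>h. 0 < h \<Longrightarrow> h < d \<Longrightarrow> h \<le> c \<Longrightarrow> norm (w c - w (c - h)) \<le> g"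
        using left[OF \<open>c > 0\<close> ct \<open>g > 0\<close>] by blast
      define h where "h = min (d/2) c"
      have h: "0 < h" "h < d" "h \<le> c" using d \<open>c > 0\<close> by (auto simp: h_def)
      have "norm (w c - w 0) \<le> norm (w c - w (c - h)) + norm (w (c - h) - w 0)"
        by (metis diff_add_cancel add_diff_eq norm_triangle_ineq)
      also have "norm (w c - w (c - h)) \<le> g" using d h by blast
      finally have "norm (w (c - h) - w 0) \<ge> norm (w c - w 0) - g" by simp
      moreover have "norm (w c - w 0) - g > e * (c - h)"
      proof -
        have "2 * g = norm (w c - w 0) - e * c" by (simp add: g_def)
        moreover have "0 < e * h" using \<open>e > 0\<close> h(1) by (rule mult_pos_pos)
        ultimately show ?thesis using \<open>g > 0\<close> unfolding right_diff_distrib by linarith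
      qed
      ultimately have "c - h \<in> S" using h ct by (auto simp: S_def)
      then show False using below[of "c - h"] h by simp
    qed
    then have "c < t" using \<open>t \<in> S\<close> ct by (metis less_eq_real_def)
    have cle: "norm (w c - w 0) \<le> e * c" using \<open>c \<notin> S\<close> c0 ct by (auto simp: S_def)
    obtain d where d: "d > 0" "\<And>h. 0 < h \<Longrightarrow> h < d \<Longrightarrow> c + h \<le> t \<Longrightarrow> norm (w (c + h) - w c) \<le> e * h"
      using right[OF c0 \<open>c < t\<close> \<open>e > 0\<close>] by blast
    have "c + d \<le> s" if "s \<in> S" for s
    proof (rule ccontr)
      assume "\<not> c + d \<le> s"
      have "c < s" using that below[of s] \<open>c \<notin> S\<close> by (metis linorder_neqE_linordered_idom)
      have "norm (w s - w 0) \<le> norm (w s - w c) + norm (w c - w 0)"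
        by (metis diff_add_cancel add_diff_eq norm_triangle_ineq)
      also have "norm (w s - w c) \<le> e * (s - c)"
        using d(2)[of "s - c"] \<open>c < s\<close> \<open>\<not> c + d \<le> s\<close> that by (auto simp: S_def)
      finally have "norm (w s - w 0) \<le> e * s" using cle by (simp add: algebra_simps)
      then show False using that by (simp add: S_def)
    qed
    then have "c + d \<le> c" unfolding c_def using \<open>t \<in> S\<close> by (intro cInf_greatest) auto
    then show False using d by simp
  qed
  have "norm (w t - w 0) \<le> 0 + e" if "e > 0" for e
  proof -
    have "e / (t + 1) > 0" using that \<open>t \<ge> 0\<close> by simp
    from bound[OF this] have "norm (w t - w 0) \<le> e * (t / (t + 1))" by simp
    also have "\<dots> \<le> e * 1" using that \<open>t \<ge> 0\<close> by (intro mult_left_mono) auto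
    finally show ?thesis by simp
  qed
  then have "norm (w t - w 0) \<le> 0" by (rule field_le_epsilon)
  then show ?thesis by simp
qed

context
  fixes P :: "real \<Rightarrow> 'a::topological_space \<Rightarrow> 'a measure"
  assumes P: "markov_semigroup P"
begin

lemma kernel_measurable: "t \<ge> 0 \<Longrightarrow> P t \<in> borel \<rightarrow>\<^sub>M prob_algebra borel"
  using P by (simp add: markov_semigroup_def)

lemma kernel_prob_space: "t \<ge> 0 \<Longrightarrow> prob_space (P t x)"
  and kernel_sets: "t \<ge> 0 \<Longrightarrow> sets (P t x) = sets borel"
  using measurable_space[OF kernel_measurable, of t x] by (auto simp: space_prob_algebra)

lemma kernel_integrable:
  fixes f :: "'a \<Rightarrow> 'b::{banach, second_countable_topology}"
  assumes "t \<ge> 0" "f \<in> borel_measurable borel" "\<And>y. norm (f y) \<le> B"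
  shows "integrable (P t x) f"
proof -
  interpret prob_space "P t x" using assms(1) by (rule kernel_prob_space)
  show ?thesis
    using assms measurable_cong_sets[OF kernel_sets[OF assms(1)] refl]
    by (intro integrable_const_bound[where B = B]) auto
qed

lemma kernel_integral_bound:
  fixes f :: "'a \<Rightarrow> 'b::{banach, second_countable_topology}"
  assumes "t \<ge> 0" "f \<in> borel_measurable borel" "\<And>y. norm (f y) \<le> B"
  shows "norm (\<integral>y. f y \<partial>P t x) \<le> B"
proof -
  interpret prob_space "P t x" using assms(1) by (rule kernel_prob_space)
  have "norm (\<integral>y. f y \<partial>P t x) \<le> (\<integral>y. norm (f y) \<partial>P t x)" by (rule integral_norm_bound)
  also have "\<dots> \<le> (\<integral>y. B \<partial>P t x)"
    using kernel_integrable[OF assms] assms(3) by (intro integral_mono) auto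
  finally show ?thesis by (simp add: prob_space)
qed

lemma kernel_integral_measurable:
  fixes f :: "'a \<Rightarrow> 'b::{banach, second_countable_topology}"
  assumes "t \<ge> 0" "f \<in> borel_measurable borel"
  shows "(\<lambda>x. \<integral>y. f y \<partial>P t x) \<in> borel_measurable borel"
  using measurable_compose[OF measurable_prob_algebraD[OF kernel_measurable[OF assms(1)]]
      integral_measurable_subprob_algebra[OF assms(2)]] .

text \<open>The Chapman-Kolmogorov equation for complex functions, reduced to real and imaginary parts.\<close>

lemma kernel_integral_semigroup:
  fixes f :: "'a \<Rightarrow> complex"
  assumes st: "s \<ge> 0" "t \<ge> 0" and f: "f \<in> borel_measurable borel" "\<And>y. norm (f y) \<le> B"
  shows "(\<integral>y. f y \<partial>P (s + t) x) = (\<integral>y. (\<integral>z. f z \<partial>P t y) \<partial>P s x)"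
proof -
  have real: "(\<integral>y. g y \<partial>P (s + t) x) = (\<integral>y. (\<integral>z. g z \<partial>P t y) \<partial>P s x)"
    if g: "g \<in> borel_measurable borel" "\<And>y. \<bar>g y\<bar> \<le> B" for g :: "'a \<Rightarrow> real"
  proof -
    have "P (s + t) x = P s x \<bind> P t" using P st by (simp add: markov_semigroup_def)
    moreover have "P t \<in> P s x \<rightarrow>\<^sub>M subprob_algebra borel"
      using measurable_prob_algebraD[OF kernel_measurable[OF st(2)]]
        measurable_cong_sets[OF kernel_sets[OF st(1)] refl] by auto
    moreover have "finite_measure (P s x)"
      using kernel_prob_space[OF st(1)] by (simp add: prob_space_def)
    moreover have "emeasure (P t y) (space (P t y)) \<le> ennreal 1" for y
      using prob_space.emeasure_space_1[OF kernel_prob_space[OF st(2)]] by simp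
    ultimately show ?thesis using g by (simp add: integral_bind[where K = borel and B = B and B' = 1])
  qed
  have bR: "\<bar>Re (f y)\<bar> \<le> B" and bI: "\<bar>Im (f y)\<bar> \<le> B" for y
    using f(2)[of y] abs_Re_le_cmod[of "f y"] abs_Im_le_cmod[of "f y"] by linarith+
  have int: "integrable (P u y) f" if "u \<ge> 0" for u y
    using that f by (rule kernel_integrable)
  have int': "integrable (P s x) (\<lambda>y. \<integral>z. f z \<partial>P t y)"
    using st f by (intro kernel_integrable kernel_integral_measurable kernel_integral_bound)
  show ?thesis
  proof (rule complex_eqI)
    have "Re (\<integral>y. f y \<partial>P (s + t) x) = (\<integral>y. Re (f y) \<partial>P (s + t) x)"
      using int st by simp
    also have "\<dots> = (\<integral>y. (\<integral>z. Re (f z) \<partial>P t y) \<partial>P s x)"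
      using f bR by (intro real) auto
    also have "\<dots> = Re (\<integral>y. (\<integral>z. f z \<partial>P t y) \<partial>P s x)"
      using int int' st by simp
    finally show "Re (\<integral>y. f y \<partial>P (s + t) x) = Re (\<integral>y. (\<integral>z. f z \<partial>P t y) \<partial>P s x)" .
    have "Im (\<integral>y. f y \<partial>P (s + t) x) = (\<integral>y. Im (f y) \<partial>P (s + t) x)"
      using int st by simp
    also have "\<dots> = (\<integral>y. (\<integral>z. Im (f z) \<partial>P t y) \<partial>P s x)"
      using f bI by (intro real) auto
    also have "\<dots> = Im (\<integral>y. (\<integral>z. f z \<partial>P t y) \<partial>P s x)"
      using int int' st by simp
    finally show "Im (\<integral>y. f y \<partial>P (s + t) x) = Im (\<integral>y. (\<integral>z. f z \<partial>P t y) \<partial>P s x)" .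
  qed
qed

text \<open>
The interpolation \<open>w s = P\<^sub>t\<^sub>-\<^sub>s F\<^sub>s\<close> runs from \<open>P\<^sub>t F\<^sub>0\<close> to \<open>F\<^sub>t\<close>. As \<open>P\<^sub>t\<^sub>-\<^sub>s\<^sub>-\<^sub>h\<close> is a contraction for the
supremum norm, the increment of \<open>w\<close> over \<open>[s, s + h]\<close> is at most \<open>\<parallel>F\<^sub>s\<^sub>+\<^sub>h - P\<^sub>h F\<^sub>s\<parallel>\<close>, and there the first
order terms \<open>h G\<^sub>s\<close> cancel, since both expansions are taken at the fixed left end point \<open>s\<close>.
\<close>

lemma backward_equation_solution:
  assumes gen: "\<And>s. s \<ge> 0 \<Longrightarrow> (F s, G s) \<in> inf_generator P"
    and der: "\<And>s. s \<ge> 0 \<Longrightarrow>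
      uniform_limit UNIV (\<lambda>h y. (F (s + h) y - F s y) / of_real h) (G s) (at 0)"
    and "t \<ge> 0"
  shows "(\<integral>y. F 0 y \<partial>P t x) = F t x"
proof -
  have Fm: "F s \<in> borel_measurable borel" if "s \<ge> 0" for s
    using gen[OF that] by (simp add: inf_generator_def)
  have Fb: "\<exists>B. \<forall>y. norm (F s y) \<le> B" and Gb: "\<exists>B. \<forall>y. norm (G s y) \<le> B" if "s \<ge> 0" for s
    using gen[OF that] by (auto simp: inf_generator_def bounded_iff)
  have derE: "\<exists>d>0. \<forall>h y. h \<noteq> 0 \<longrightarrow> \<bar>h\<bar> < d \<longrightarrow> norm (F (s + h) y - F s y - of_real h * G s y) \<le> e * \<bar>h\<bar>"
    if s: "s \<ge> 0" and e: "e > 0" for s e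
  proof -
    from uniform_limitD[OF der[OF s] e] obtain d where d: "d > 0"
      "\<And>h y. h \<noteq> 0 \<Longrightarrow> \<bar>h\<bar> < d \<Longrightarrow> dist ((F (s + h) y - F s y) / of_real h) (G s y) < e"
      by (auto simp: eventually_at)
    have "norm (F (s + h) y - F s y - of_real h * G s y) \<le> e * \<bar>h\<bar>" if "h \<noteq> 0" "\<bar>h\<bar> < d" for h y
    proof -
      have "F (s + h) y - F s y - of_real h * G s y
          = of_real h * ((F (s + h) y - F s y) / of_real h - G s y)"
        using that(1) by (simp add: field_simps)
      then show ?thesis
        using mult_left_mono[OF less_imp_le[OF d(2)[OF that, of y]], of "\<bar>h\<bar>"]
        by (simp add: norm_mult dist_norm mult.commute)
    qed
    then show ?thesis using d(1) by blast
  qed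
  have genE: "\<exists>d>0. \<forall>h y. 0 < h \<longrightarrow> h < d \<longrightarrow> norm ((\<integral>z. F s z \<partial>P h y) - F s y - of_real h * G s y) \<le> e * h"
    if s: "s \<ge> 0" and e: "e > 0" for s e
  proof -
    have "uniform_limit UNIV (\<lambda>h y. ((\<integral>z. F s z \<partial>P h y) - F s y) / of_real h) (G s) (at_right 0)"
      using gen[OF s] by (simp add: inf_generator_def)
    from uniform_limitD[OF this e] obtain d where d: "d > 0"
      "\<And>h y. h > 0 \<Longrightarrow> h < d \<Longrightarrow> dist (((\<integral>z. F s z \<partial>P h y) - F s y) / of_real h) (G s y) < e"
      by (auto simp: eventually_at_right_field)
    have "norm ((\<integral>z. F s z \<partial>P h y) - F s y - of_real h * G s y) \<le> e * h" if "0 < h" "h < d" for h y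
    proof -
      have "(\<integral>z. F s z \<partial>P h y) - F s y - of_real h * G s y
          = of_real h * (((\<integral>z. F s z \<partial>P h y) - F s y) / of_real h - G s y)"
        using that(1) by (simp add: field_simps)
      then show ?thesis
        using mult_left_mono[OF less_imp_le[OF d(2)[OF that, of y]], of h] that
        by (simp add: norm_mult dist_norm mult.commute)
    qed
    then show ?thesis using d(1) by blast
  qed
  define w where "w s = (\<integral>y. F s y \<partial>P (t - s) x)" for s
  \<comment> \<open>the contraction estimate; it serves both the right derivative and left continuity\<close>
  have step: "norm (w (s + h) - w s) \<le> C"
    if s: "s \<ge> 0" and h: "h > 0" and t: "s + h \<le> t"
      and C: "\<And>y. norm (F (s + h) y - (\<integral>z. F s z \<partial>P h y)) \<le> C" for s h C
  proof -
    obtain B where B: "\<And>y. norm (F s y) \<le> B" using Fb[OF s] by blast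
    obtain B' where B': "\<And>y. norm (F (s + h) y) \<le> B'" using Fb[of "s + h"] s h by auto
    have nn: "t - (s + h) \<ge> 0" using t by simp
    have "w s = (\<integral>y. (\<integral>z. F s z \<partial>P h y) \<partial>P (t - (s + h)) x)"
      using kernel_integral_semigroup[OF nn less_imp_le[OF h] Fm[OF s] B, of x] by (simp add: w_def)
    then have "w (s + h) - w s = (\<integral>y. F (s + h) y - (\<integral>z. F s z \<partial>P h y) \<partial>P (t - (s + h)) x)"
      unfolding w_def using nn h s Fm B B'
      by (subst Bochner_Integration.integral_diff)
        (auto intro!: kernel_integrable kernel_integral_measurable kernel_integral_bound)
    also have "norm \<dots> \<le> C"
      using nn h s Fm C
      by (intro kernel_integral_bound borel_measurable_diff kernel_integral_measurable) auto
    finally show ?thesis .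
  qed
  have "w t = w 0"
  proof (rule right_derivative_zero_imp_const[OF \<open>t \<ge> 0\<close>])
    fix s e :: real assume s: "0 < s" "s \<le> t" and e: "e > 0"
    obtain B where B: "\<And>y. norm (G s y) \<le> B" using Gb[of s] s by auto
    have B0: "B \<ge> 0" using B[of undefined] norm_ge_zero order_trans by blast
    obtain d1 where d1: "d1 > 0"
      "\<And>h y. h \<noteq> 0 \<Longrightarrow> \<bar>h\<bar> < d1 \<Longrightarrow> norm (F (s + h) y - F s y - of_real h * G s y) \<le> 1 * \<bar>h\<bar>"
      using derE[of s 1] s by auto
    obtain d2 where d2: "d2 > 0"
      "\<And>h y. 0 < h \<Longrightarrow> h < d2 \<Longrightarrow> norm ((\<integral>z. F s z \<partial>P h y) - F s y - of_real h * G s y) \<le> 1 * h"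
      using genE[of s 1] s by auto
    define d where "d = min (min d1 d2) (e / (2 * (B + 1)))"
    have "d > 0" using d1 d2 e B0 by (simp add: d_def)
    moreover have "norm (w s - w (s - h)) \<le> e" if h: "0 < h" "h < d" "h \<le> s" for h
    proof -
      have lip: "norm (F (s - h) y - F s y) \<le> h * (B + 1)" for y
      proof -
        have "norm (F (s - h) y - F s y) \<le> norm (F (s - h) y - F s y + of_real h * G s y) + norm (of_real h * G s y)"
          by (metis add_diff_cancel norm_triangle_ineq4)
        also have "\<dots> \<le> h + h * B"
          using d1(2)[of "- h" y] h B[of y] by (intro add_mono) (auto simp: d_def norm_mult)
        finally show ?thesis by (simp add: algebra_simps)
      qed
      have lip': "norm ((\<integral>z. F s z \<partial>P h y) - F s y) \<le> h * (B + 1)" for y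
      proof -
        have "norm ((\<integral>z. F s z \<partial>P h y) - F s y)
            \<le> norm ((\<integral>z. F s z \<partial>P h y) - F s y - of_real h * G s y) + norm (of_real h * G s y)"
          by (metis diff_add_cancel norm_triangle_ineq)
        also have "\<dots> \<le> h + h * B"
          using d2(2)[of "h" y] h B[of y] by (intro add_mono) (auto simp: d_def norm_mult)
        finally show ?thesis by (simp add: algebra_simps)
      qed
      have he: "2 * (h * (B + 1)) \<le> e" using h B0 by (auto simp: d_def field_simps)
      have "norm (F s y - (\<integral>z. F (s - h) z \<partial>P h y)) \<le> e" for y
      proof -
        obtain C where C: "\<And>y. norm (F s y) \<le> C" using Fb[of s] s by auto
        obtain C' where C': "\<And>y. norm (F (s - h) y) \<le> C'" using Fb[of "s - h"] h by auto
        have "(\<integral>z. F (s - h) z - F s z \<partial>P h y) = (\<integral>z. F (s - h) z \<partial>P h y) - (\<integral>z. F s z \<partial>P h y)"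
          using h s Fm C C' by (intro Bochner_Integration.integral_diff kernel_integrable) auto
        moreover have "norm (\<integral>z. F (s - h) z - F s z \<partial>P h y) \<le> h * (B + 1)"
          using h s Fm lip by (intro kernel_integral_bound) auto
        ultimately have "norm ((\<integral>z. F (s - h) z \<partial>P h y) - (\<integral>z. F s z \<partial>P h y)) \<le> h * (B + 1)" by simp
        from norm_triangle_le[OF add_mono[OF this lip'[of y]]]
        have "norm ((\<integral>z. F (s - h) z \<partial>P h y) - F s y) \<le> h * (B + 1) + h * (B + 1)" by simp
        then show ?thesis using he by (simp add: norm_minus_commute)
      qed
      then show ?thesis using step[of "s - h" h e] h s by simp
    qed
    ultimately show "\<exists>d>0. \<forall>h. 0 < h \<and> h < d \<and> h \<le> s \<longrightarrow> norm (w s - w (s - h)) \<le> e" by blast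
  next
    fix s e :: real assume s: "0 \<le> s" "s < t" and e: "e > 0"
    then have e2: "e / 2 > 0" by simp
    obtain d1 where d1: "d1 > 0"
      "\<And>h y. h \<noteq> 0 \<Longrightarrow> \<bar>h\<bar> < d1 \<Longrightarrow> norm (F (s + h) y - F s y - of_real h * G s y) \<le> e/2 * \<bar>h\<bar>"
      using derE[OF s(1) e2] by auto
    obtain d2 where d2: "d2 > 0"
      "\<And>h y. 0 < h \<Longrightarrow> h < d2 \<Longrightarrow> norm ((\<integral>z. F s z \<partial>P h y) - F s y - of_real h * G s y) \<le> e/2 * h"
      using genE[OF s(1) e2] by auto
    have "norm (w (s + h) - w s) \<le> e * h" if h: "0 < h" "h < min d1 d2" "s + h \<le> t" for h
    proof (rule step[OF s(1) h(1,3)])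
      fix y
      have "norm (F (s + h) y - (\<integral>z. F s z \<partial>P h y))
          \<le> norm (F (s + h) y - F s y - of_real h * G s y)
            + norm ((\<integral>z. F s z \<partial>P h y) - F s y - of_real h * G s y)"
        using norm_triangle_ineq4[of "F (s + h) y - F s y - of_real h * G s y"
            "(\<integral>z. F s z \<partial>P h y) - F s y - of_real h * G s y"] by simp
      also have "\<dots> \<le> e/2 * h + e/2 * h"
        using d1(2)[of h y] d2(2)[of h y] h by (intro add_mono) auto
      finally show "norm (F (s + h) y - (\<integral>z. F s z \<partial>P h y)) \<le> e * h" by simp
    qed
    then show "\<exists>d>0. \<forall>h. 0 < h \<and> h < d \<and> s + h \<le> t \<longrightarrow> norm (w (s + h) - w s) \<le> e * h"
      using d1(1) d2(1) by (intro exI[of _ "min d1 d2"]) auto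
  qed
  moreover have "w t = F t x"
    using P Fm[OF \<open>t \<ge> 0\<close>] by (simp add: w_def markov_semigroup_def integral_return)
  ultimately show ?thesis by (simp add: w_def)
qed

end

section \<open>Wirtinger calculus and the generator on coherences\<close>

text \<open>
The Wirtinger derivatives of \<open>f\<close> encoded as coefficients of its real Frechet derivative, so that the
calculus is inherited from \<open>has_derivative\<close>. The order of the coefficients is
\<open>\<partial>\<^sub>e\<close>, conjugate \<open>\<partial>\<^sub>e\<close>, \<open>\<partial>\<^sub>o\<close>, conjugate \<open>\<partial>\<^sub>o\<close>.
\<close>

definition has_wirtinger ::
    "(amplitudes \<Rightarrow> complex) \<Rightarrow> complex \<Rightarrow> complex \<Rightarrow> complex \<Rightarrow> complex \<Rightarrow> amplitudes \<Rightarrow> bool" where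
  "has_wirtinger f A A' B B' a \<longleftrightarrow>
     (f has_derivative (\<lambda>v. A * fst v + A' * cnj (fst v) + B * snd v + B' * cnj (snd v))) (at a)"

lemma partial_deriv_eq:
  assumes "(f has_derivative f') (at a)"
  shows "((\<lambda>t::real. f (a + t *\<^sub>R v)) has_vector_derivative f' v) (at 0)"
    and "partial_deriv v f a = f' v"
proof -
  have "((\<lambda>t::real. a + t *\<^sub>R v) has_derivative (\<lambda>t. t *\<^sub>R v)) (at 0)"
    by (auto intro!: derivative_eq_intros)
  from has_derivative_compose[OF this, of f f'] assms
  have "((\<lambda>t::real. f (a + t *\<^sub>R v)) has_derivative (\<lambda>t. f' (t *\<^sub>R v))) (at 0)" by simp
  moreover have "f' (t *\<^sub>R v) = t *\<^sub>R f' v" for t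
    using has_derivative_linear[OF assms] by (simp add: linear_cmul)
  ultimately show *: "((\<lambda>t::real. f (a + t *\<^sub>R v)) has_vector_derivative f' v) (at 0)"
    by (simp add: has_vector_derivative_def)
  then show "partial_deriv v f a = f' v"
    unfolding partial_deriv_def by (rule vector_derivative_at)
qed

lemma has_wirtinger_partial_deriv:
  assumes "has_wirtinger f A A' B B' a"
  shows "partial_deriv v f a = A * fst v + A' * cnj (fst v) + B * snd v + B' * cnj (snd v)"
  using partial_deriv_eq(2)[OF assms[unfolded has_wirtinger_def]] .

lemma has_wirtinger_wirt:
  assumes "has_wirtinger f A A' B B' a"
  shows "wirt Even f a = A" "wirt_bar Even f a = A'" "wirt Odd f a = B" "wirt_bar Odd f a = B'"
  unfolding wirt_def wirt_bar_def has_wirtinger_partial_deriv[OF assms]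
  by (simp_all add: algebra_simps)

lemma has_wirtinger_const: "has_wirtinger (\<lambda>a. c) 0 0 0 0 a"
  and has_wirtinger_fst: "has_wirtinger (\<lambda>a. fst a) 1 0 0 0 a"
  and has_wirtinger_cnj_fst: "has_wirtinger (\<lambda>a. cnj (fst a)) 0 1 0 0 a"
  and has_wirtinger_snd: "has_wirtinger (\<lambda>a. snd a) 0 0 1 0 a"
  and has_wirtinger_cnj_snd: "has_wirtinger (\<lambda>a. cnj (snd a)) 0 0 0 1 a"
  by (auto simp: has_wirtinger_def intro!: derivative_eq_intros)

lemma has_wirtinger_add:
  assumes "has_wirtinger f A A' B B' a" "has_wirtinger g C C' D D' a"
  shows "has_wirtinger (\<lambda>a. f a + g a) (A + C) (A' + C') (B + D) (B' + D') a"
  using assms unfolding has_wirtinger_def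
  by (auto intro!: derivative_eq_intros simp: algebra_simps)

lemma has_wirtinger_mult:
  assumes "has_wirtinger f A A' B B' a" "has_wirtinger g C C' D D' a"
  shows "has_wirtinger (\<lambda>a. f a * g a) (A * g a + f a * C) (A' * g a + f a * C')
    (B * g a + f a * D) (B' * g a + f a * D') a"
  using assms unfolding has_wirtinger_def
  by (auto intro!: derivative_eq_intros simp: algebra_simps)

lemma has_wirtinger_radial:
  assumes "\<And>\<rho>. (K has_field_derivative K' \<rho>) (at \<rho>)"
  shows "has_wirtinger (\<lambda>a. of_real (K ((norm a)\<^sup>2)))
    (cnj (fst a) * of_real (K' ((norm a)\<^sup>2))) (fst a * of_real (K' ((norm a)\<^sup>2)))
    (cnj (snd a) * of_real (K' ((norm a)\<^sup>2))) (snd a * of_real (K' ((norm a)\<^sup>2))) a"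
proof -
  have "((\<lambda>a::amplitudes. (norm a)\<^sup>2) has_derivative (\<lambda>v. 2 * (a \<bullet> v))) (at a)"
    unfolding power2_norm_eq_inner by (auto intro!: derivative_eq_intros simp: inner_commute)
  moreover have "(K has_derivative (\<lambda>x. K' ((norm a)\<^sup>2) * x)) (at ((norm a)\<^sup>2))"
    using assms by (simp add: has_field_derivative_def)
  ultimately have "((\<lambda>a. K ((norm a)\<^sup>2)) has_derivative (\<lambda>v. K' ((norm a)\<^sup>2) * (2 * (a \<bullet> v)))) (at a)"
    by (rule has_derivative_compose)
  then have "((\<lambda>a. complex_of_real (K ((norm a)\<^sup>2))) has_derivative
      (\<lambda>v. of_real (K' ((norm a)\<^sup>2) * (2 * (a \<bullet> v))))) (at a)"
    by (rule bounded_linear.has_derivative[OF bounded_linear_of_real])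
  moreover have "complex_of_real (K' ((norm a)\<^sup>2) * (2 * (a \<bullet> v))) =
      cnj (fst a) * of_real (K' ((norm a)\<^sup>2)) * fst v + fst a * of_real (K' ((norm a)\<^sup>2)) * cnj (fst v)
    + cnj (snd a) * of_real (K' ((norm a)\<^sup>2)) * snd v + snd a * of_real (K' ((norm a)\<^sup>2)) * cnj (snd v)" for v
    by (simp add: complex_eq_iff inner_prod_def inner_complex_def algebra_simps)
  ultimately show ?thesis unfolding has_wirtinger_def by (simp only:)
qed

definition C1_wirtinger :: "(amplitudes \<Rightarrow> complex) \<Rightarrow> bool" where
  "C1_wirtinger f \<longleftrightarrow> (\<exists>A A' B B'. (\<forall>a. has_wirtinger f (A a) (A' a) (B a) (B' a) a) \<and>
     continuous_on UNIV A \<and> continuous_on UNIV A' \<and> continuous_on UNIV B \<and> continuous_on UNIV B')"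

lemma C1_wirtingerI:
  assumes "\<And>a. has_wirtinger f (A a) (A' a) (B a) (B' a) a"
    and "continuous_on UNIV A" "continuous_on UNIV A'" "continuous_on UNIV B" "continuous_on UNIV B'"
  shows "C1_wirtinger f"
  using assms unfolding C1_wirtinger_def by blast

lemma C1_wirtinger_C1_fun: "C1_wirtinger f \<Longrightarrow> C1_fun f"
  unfolding C1_wirtinger_def C1_fun_def
proof (elim exE conjE, intro ballI conjI allI)
  fix A A' B B' v x
  assume *: "\<forall>a. has_wirtinger f (A a) (A' a) (B a) (B' a) a"
  and c: "continuous_on UNIV A" "continuous_on UNIV A'" "continuous_on UNIV B" "continuous_on UNIV B'"
  show "(\<lambda>t::real. f (x + t *\<^sub>R v)) differentiable at 0"
    using partial_deriv_eq(1)[OF *[rule_format, unfolded has_wirtinger_def]]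
    by (rule differentiableI_vector)
  have "partial_deriv v f = (\<lambda>a. A a * fst v + A' a * cnj (fst v) + B a * snd v + B' a * cnj (snd v))"
    using * by (intro ext has_wirtinger_partial_deriv) (rule spec)
  then show "continuous_on UNIV (partial_deriv v f)" using c by (auto intro!: continuous_intros)
qed

lemma C1_wirtinger_continuous: "C1_wirtinger f \<Longrightarrow> continuous_on UNIV f"
  unfolding C1_wirtinger_def has_wirtinger_def
  by (meson has_derivative_continuous continuous_at_imp_continuous_on)

lemma C1_wirtinger_add: "C1_wirtinger f \<Longrightarrow> C1_wirtinger g \<Longrightarrow> C1_wirtinger (\<lambda>a. f a + g a)"
proof -
  assume "C1_wirtinger f" "C1_wirtinger g"
  then obtain A A' B B' C C' D D' where
    "\<And>a. has_wirtinger f (A a) (A' a) (B a) (B' a) a" "\<And>a. has_wirtinger g (C a) (C' a) (D a) (D' a) a"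
    "continuous_on UNIV A" "continuous_on UNIV A'" "continuous_on UNIV B" "continuous_on UNIV B'"
    "continuous_on UNIV C" "continuous_on UNIV C'" "continuous_on UNIV D" "continuous_on UNIV D'"
    unfolding C1_wirtinger_def by blast
  note * = this
  show ?thesis unfolding C1_wirtinger_def
    by (rule exI[of _ "\<lambda>a. A a + C a"], rule exI[of _ "\<lambda>a. A' a + C' a"],
        rule exI[of _ "\<lambda>a. B a + D a"], rule exI[of _ "\<lambda>a. B' a + D' a"])
      (use * has_wirtinger_add in \<open>auto intro!: continuous_intros\<close>)
qed

lemma C1_wirtinger_mult: "C1_wirtinger f \<Longrightarrow> C1_wirtinger g \<Longrightarrow> C1_wirtinger (\<lambda>a. f a * g a)"
proof -
  assume fg: "C1_wirtinger f" "C1_wirtinger g"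
  then obtain A A' B B' C C' D D' where
    "\<And>a. has_wirtinger f (A a) (A' a) (B a) (B' a) a" "\<And>a. has_wirtinger g (C a) (C' a) (D a) (D' a) a"
    "continuous_on UNIV A" "continuous_on UNIV A'" "continuous_on UNIV B" "continuous_on UNIV B'"
    "continuous_on UNIV C" "continuous_on UNIV C'" "continuous_on UNIV D" "continuous_on UNIV D'"
    unfolding C1_wirtinger_def by blast
  note * = this fg[THEN C1_wirtinger_continuous]
  show ?thesis unfolding C1_wirtinger_def
    by (rule exI[of _ "\<lambda>a. A a * g a + f a * C a"], rule exI[of _ "\<lambda>a. A' a * g a + f a * C' a"],
        rule exI[of _ "\<lambda>a. B a * g a + f a * D a"], rule exI[of _ "\<lambda>a. B' a * g a + f a * D' a"])
      (use * has_wirtinger_mult in \<open>auto intro!: continuous_intros\<close>)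
qed

lemma C1_wirtinger_coordinates:
  "C1_wirtinger (\<lambda>a. c)" "C1_wirtinger fst" "C1_wirtinger snd"
  "C1_wirtinger (\<lambda>a. cnj (fst a))" "C1_wirtinger (\<lambda>a. cnj (snd a))"
  by (rule C1_wirtingerI, rule has_wirtinger_const has_wirtinger_fst has_wirtinger_snd
      has_wirtinger_cnj_fst has_wirtinger_cnj_snd, (rule continuous_on_const)+)+

lemma C1_wirtinger_radial:
  assumes "\<And>\<rho>. (K has_field_derivative K' \<rho>) (at \<rho>)" "continuous_on UNIV K'"
  shows "C1_wirtinger (\<lambda>a. of_real (K ((norm a)\<^sup>2)))"
  unfolding C1_wirtinger_def
  by (rule exI, rule exI, rule exI, rule exI, rule conjI, rule allI, rule has_wirtinger_radial[OF assms(1)])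
    (auto intro!: continuous_intros continuous_on_compose2[OF assms(2)])

lemmas C1_wirtinger_intros =
  C1_wirtinger_add C1_wirtinger_mult C1_wirtinger_coordinates C1_wirtinger_radial

text \<open>
A directional derivative is a combination of the four Wirtinger derivatives with constant
coefficients, so their regularity carries over.
\<close>

lemma C2_funI:
  assumes "\<And>a. has_wirtinger f (A a) (A' a) (B a) (B' a) a"
    and "C1_wirtinger A" "C1_wirtinger A'" "C1_wirtinger B" "C1_wirtinger B'"
  shows "C2_fun f"
  unfolding C2_fun_def
proof (intro conjI ballI)
  show "C1_fun f"
    by (intro C1_wirtinger_C1_fun C1_wirtingerI[OF assms(1)] C1_wirtinger_continuous assms(2-5))
  fix v
  have "partial_deriv v f = (\<lambda>a. A a * fst v + A' a * cnj (fst v) + B a * snd v + B' a * cnj (snd v))"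
    using assms(1) by (intro ext has_wirtinger_partial_deriv)
  moreover have "C1_wirtinger \<dots>" using assms by (intro C1_wirtinger_intros)
  ultimately show "C1_fun (partial_deriv v f)" by (simp add: C1_wirtinger_C1_fun)
qed

lemma of_real_norm_power2_prod:
  "complex_of_real ((norm (a :: amplitudes))\<^sup>2) = fst a * cnj (fst a) + snd a * cnj (snd a)"
  by (simp add: norm_prod_def complex_norm_square flip: complex_norm_square of_real_add of_real_power)

text \<open>
All second derivatives of \<open>K(r)\<close> cancel, as do the terms with \<open>\<Theta>\<close> and \<open>\<nu>\<close>. Letting \<open>c\<close> and \<open>c'\<close> vary
treats the power (\<open>c' = 0\<close>) and the coherence (\<open>c = 0\<close>) in one computation.
\<close>

lemma coupler_gen_coherence:
  fixes c c' :: complex and K K' K'' :: "real \<Rightarrow> real"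
  defines "p \<equiv> \<lambda>a :: amplitudes. c + c' * (snd a * cnj (fst a))"
  assumes K: "\<And>\<rho>. (K has_field_derivative K' \<rho>) (at \<rho>)"
    and K': "\<And>\<rho>. (K' has_field_derivative K'' \<rho>) (at \<rho>)"
    and K'': "continuous_on UNIV K''"
    and R: "\<forall>\<rho>\<ge>R. K \<rho> = 0"
  shows "(\<lambda>a. p a * of_real (K ((norm a)\<^sup>2))) \<in> C2c"
    and "coupler_gen \<Gamma> \<Lambda> \<Theta> \<nu> (\<lambda>a. p a * of_real (K ((norm a)\<^sup>2))) a
      = - of_real (\<Gamma> + \<Lambda>) * (c' * (snd a * cnj (fst a))) * of_real (K ((norm a)\<^sup>2))
        - of_real (\<Lambda> * (norm a)\<^sup>2 * K' ((norm a)\<^sup>2)) * p a"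
proof -
  define f where "f = (\<lambda>a. p a * complex_of_real (K ((norm a)\<^sup>2)))"
  define k where "k = (\<lambda>a::amplitudes. complex_of_real (K ((norm a)\<^sup>2)))"
  define k' where "k' = (\<lambda>a::amplitudes. complex_of_real (K' ((norm a)\<^sup>2)))"
  define k'' where "k'' = (\<lambda>a::amplitudes. complex_of_real (K'' ((norm a)\<^sup>2)))"
  have contK': "continuous_on UNIV K'"
    using K' by (meson DERIV_isCont continuous_at_imp_continuous_on)
  have wp: "has_wirtinger p 0 (c' * snd a) (c' * cnj (fst a)) 0 a" for a
    using has_wirtinger_add[OF has_wirtinger_const has_wirtinger_mult[OF has_wirtinger_const
      has_wirtinger_mult[OF has_wirtinger_snd has_wirtinger_cnj_fst]], of c c' a] by (simp add: p_def)
  have wk: "has_wirtinger k (cnj (fst a) * k' a) (fst a * k' a) (cnj (snd a) * k' a) (snd a * k' a) a"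
    and wk': "has_wirtinger k' (cnj (fst a) * k'' a) (fst a * k'' a) (cnj (snd a) * k'' a) (snd a * k'' a) a" for a
    using has_wirtinger_radial[OF K, of a] has_wirtinger_radial[OF K', of a]
    by (simp_all add: k_def k'_def k''_def)
  have f_eq: "f = (\<lambda>a. p a * k a)" by (simp add: f_def k_def)
  define A where "A = (\<lambda>a. p a * (cnj (fst a) * k' a))"
  define A' where "A' = (\<lambda>a. c' * (snd a * k a) + p a * (fst a * k' a))"
  define B where "B = (\<lambda>a. c' * (cnj (fst a) * k a) + p a * (cnj (snd a) * k' a))"
  define B' where "B' = (\<lambda>a. p a * (snd a * k' a))"
  have wf: "has_wirtinger f (A a) (A' a) (B a) (B' a) a" for a
    unfolding f_eq A_def A'_def B_def B'_def
    using has_wirtinger_mult[OF wp wk] by (simp add: mult.assoc)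
  have C1p: "C1_wirtinger p" unfolding p_def by (intro C1_wirtinger_intros)
  have C1k: "C1_wirtinger k" unfolding k_def by (rule C1_wirtinger_radial[OF K contK'])
  have C1k': "C1_wirtinger k'" unfolding k'_def by (rule C1_wirtinger_radial[OF K' K''])
  have "C2_fun f"
    by (rule C2_funI[OF wf]; unfold A_def A'_def B_def B'_def)
      (intro C1_wirtinger_add C1_wirtinger_mult C1_wirtinger_coordinates C1p C1k C1k')+
  moreover have "f a = 0" if "a \<notin> cball 0 (sqrt \<bar>R\<bar>)" for a
  proof -
    have "sqrt \<bar>R\<bar> < norm a" using that by simp
    then have "(sqrt \<bar>R\<bar>)\<^sup>2 < (norm a)\<^sup>2" by (intro power_strict_mono) auto
    then have "R \<le> (norm a)\<^sup>2" by simp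
    then show ?thesis using R by (simp add: f_def)
  qed
  ultimately show "(\<lambda>a. p a * of_real (K ((norm a)\<^sup>2))) \<in> C2c"
    unfolding f_def[symmetric] C2c_def using compact_cball by blast
  have fA: "wirt Even f = A" "wirt_bar Even f = A'" "wirt Odd f = B" "wirt_bar Odd f = B'"
    using has_wirtinger_wirt[OF wf] by (intro ext; simp)+
  have wA: "has_wirtinger A (p a * (cnj (fst a) * (cnj (fst a) * k'' a)))
      (c' * snd a * (cnj (fst a) * k' a) + p a * (k' a + cnj (fst a) * (fst a * k'' a)))
      (c' * cnj (fst a) * (cnj (fst a) * k' a) + p a * (cnj (fst a) * (cnj (snd a) * k'' a)))
      (p a * (cnj (fst a) * (snd a * k'' a))) a"
    unfolding A_def
    using has_wirtinger_mult[OF wp has_wirtinger_mult[OF has_wirtinger_cnj_fst wk'], of a] by simp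
  have wB': "has_wirtinger B' (p a * (snd a * (cnj (fst a) * k'' a)))
      (c' * snd a * (snd a * k' a) + p a * (snd a * (fst a * k'' a)))
      (c' * cnj (fst a) * (snd a * k' a) + p a * (k' a + snd a * (cnj (snd a) * k'' a)))
      (p a * (snd a * (snd a * k'' a))) a"
    unfolding B'_def
    using has_wirtinger_mult[OF wp has_wirtinger_mult[OF has_wirtinger_snd wk'], of a] by simp
  have wA': "has_wirtinger A'
      (c' * (snd a * (cnj (fst a) * k' a)) + p a * (k' a + fst a * (cnj (fst a) * k'' a)))
      (c' * (snd a * (fst a * k' a)) + (c' * snd a * (fst a * k' a) + p a * (fst a * (fst a * k'' a))))
      (c' * (k a + snd a * (cnj (snd a) * k' a)) + (c' * cnj (fst a) * (fst a * k' a) + p a * (fst a * (cnj (snd a) * k'' a))))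
      (c' * (snd a * (snd a * k' a)) + p a * (fst a * (snd a * k'' a))) a"
    unfolding A'_def
    using has_wirtinger_add[OF has_wirtinger_mult[OF has_wirtinger_const has_wirtinger_mult[OF has_wirtinger_snd wk]]
      has_wirtinger_mult[OF wp has_wirtinger_mult[OF has_wirtinger_fst wk']], of c' a] by simp
  have wB: "has_wirtinger B
      (c' * (cnj (fst a) * (cnj (fst a) * k' a)) + p a * (cnj (snd a) * (cnj (fst a) * k'' a)))
      (c' * (k a + cnj (fst a) * (fst a * k' a)) + (c' * snd a * (cnj (snd a) * k' a) + p a * (cnj (snd a) * (fst a * k'' a))))
      (c' * (cnj (fst a) * (cnj (snd a) * k' a)) + (c' * cnj (fst a) * (cnj (snd a) * k' a) + p a * (cnj (snd a) * (cnj (snd a) * k'' a))))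
      (c' * (cnj (fst a) * (snd a * k' a)) + p a * (k' a + cnj (snd a) * (snd a * k'' a))) a"
    unfolding B_def
    using has_wirtinger_add[OF has_wirtinger_mult[OF has_wirtinger_const has_wirtinger_mult[OF has_wirtinger_cnj_fst wk]]
      has_wirtinger_mult[OF wp has_wirtinger_mult[OF has_wirtinger_cnj_snd wk']], of c' a] by simp
  have "coupler_gen \<Gamma> \<Lambda> \<Theta> \<nu> f a
      = - of_real (\<Gamma> + \<Lambda>) * (c' * (snd a * cnj (fst a))) * k a
        - of_real \<Lambda> * (fst a * cnj (fst a) + snd a * cnj (snd a)) * k' a * p a"
    unfolding coupler_gen_def fA has_wirtinger_wirt[OF wA] has_wirtinger_wirt[OF wA']
      has_wirtinger_wirt[OF wB] has_wirtinger_wirt[OF wB'] complex_norm_square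
    by (simp add: fA has_wirtinger_wirt[OF wA] has_wirtinger_wirt[OF wA']
        has_wirtinger_wirt[OF wB] has_wirtinger_wirt[OF wB'])
      (simp add: A_def A'_def B_def B'_def p_def, algebra)
  then show "coupler_gen \<Gamma> \<Lambda> \<Theta> \<nu> (\<lambda>a. p a * of_real (K ((norm a)\<^sup>2))) a
      = - of_real (\<Gamma> + \<Lambda>) * (c' * (snd a * cnj (fst a))) * of_real (K ((norm a)\<^sup>2))
        - of_real (\<Lambda> * (norm a)\<^sup>2 * K' ((norm a)\<^sup>2)) * p a"
    unfolding f_def[symmetric] of_real_norm_power2_prod of_real_mult by (simp add: k_def k'_def)
qed

section \<open>Transition integrals of power and coherence\<close>

text \<open>
By compactness \<open>G\<^sub>u \<rightarrow> G\<^sub>s\<close> uniformly on \<open>C\<close>, hence everywhere; the mean value theorem then makes the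
convergence of the difference quotients uniform.
\<close>

lemma uniform_derivative_of_compact_support:
  fixes F G :: "real \<Rightarrow> 'a::metric_space \<Rightarrow> complex"
  assumes F: "\<And>u a. ((\<lambda>u. F u a) has_vector_derivative G u a) (at u)"
    and G: "continuous_on UNIV (\<lambda>(u, a). G u a)"
    and C: "compact C" "\<And>u a. \<bar>u - s\<bar> < 1 \<Longrightarrow> a \<notin> C \<Longrightarrow> G u a = 0"
  shows "uniform_limit UNIV (\<lambda>h a. (F (s + h) a - F s a) / of_real h) (G s) (at 0)"
proof (rule uniform_limitI)
  fix e :: real assume "e > 0"
  then have "e / 2 > 0" by simp
  have "continuous_on (UNIV \<times> C) (\<lambda>(u, a). G u a)" by (rule continuous_on_subset[OF G]) simp
  then obtain X where X: "s \<in> X" "open X"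
    and "\<forall>u\<in>X \<inter> UNIV. \<forall>a\<in>C. dist ((\<lambda>(u, a). G u a) (u, a)) ((\<lambda>(u, a). G u a) (s, a)) \<le> e / 2"
    by (rule continuous_on_prod_compactE[OF _ C(1) UNIV_I \<open>e / 2 > 0\<close>])
  then have GX: "\<And>u a. u \<in> X \<Longrightarrow> a \<in> C \<Longrightarrow> dist (G u a) (G s a) \<le> e / 2" by simp
  from X obtain d0 where d0: "d0 > 0" "ball s d0 \<subseteq> X" using openE by blast
  define d where "d = min d0 1"
  have near: "norm (G u a - G s a) \<le> e / 2" if "u \<in> ball s d" for u a
  proof (cases "a \<in> C")
    case True
    then show ?thesis using GX[of u a] that d0 by (auto simp: dist_norm d_def)
  next
    case False
    then show ?thesis using C(2)[of u a] C(2)[of s a] that \<open>e > 0\<close> by (auto simp: d_def dist_real_def)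
  qed
  have "dist ((F (s + h) a - F s a) / of_real h) (G s a) < e" if h: "h \<noteq> 0" "\<bar>h\<bar> < d" for h a
  proof -
    have "norm ((F (s + h) a - (s + h) *\<^sub>R G s a) - (F s a - s *\<^sub>R G s a)) \<le> e / 2 * norm (s + h - s)"
    proof (rule differentiable_bound[of "ball s d" _ "\<lambda>u v. v *\<^sub>R (G u a - G s a)"])
      show "((\<lambda>u. F u a - u *\<^sub>R G s a) has_derivative (\<lambda>v. v *\<^sub>R (G u a - G s a))) (at u within ball s d)" for u
      proof -
        have "((\<lambda>u. F u a - u *\<^sub>R G s a) has_vector_derivative (G u a - G s a)) (at u)"
          by (auto intro!: derivative_eq_intros F)
        then show ?thesis by (simp add: has_vector_derivative_def has_derivative_at_withinI)
      qed
      show "onorm (\<lambda>v. v *\<^sub>R (G u a - G s a)) \<le> e / 2" if "u \<in> ball s d" for u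
        using near[OF that] by (simp add: onorm_scaleR_left onorm_id)
    qed (use h d0 in \<open>auto simp: d_def dist_real_def\<close>)
    then have "norm (F (s + h) a - F s a - of_real h * G s a) \<le> e / 2 * \<bar>h\<bar>"
      by (simp add: scaleR_conv_of_real algebra_simps)
    also have "\<dots> < e * \<bar>h\<bar>" using h \<open>e > 0\<close> by simp
    finally have "norm (F (s + h) a - F s a - of_real h * G s a) < e * \<bar>h\<bar>" .
    moreover have "F (s + h) a - F s a - of_real h * G s a
        = of_real h * ((F (s + h) a - F s a) / of_real h - G s a)" using h by (simp add: field_simps)
    ultimately show ?thesis using h by (simp add: norm_mult dist_norm mult.commute)
  qed
  then show "\<forall>\<^sub>F h in at 0. \<forall>a\<in>UNIV. dist ((F (s + h) a - F s a) / of_real h) (G s a) < e"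
    using d0(1) by (auto simp: eventually_at d_def intro!: exI[of _ d])
qed

text \<open>
The rescaled cut-off \<open>K(exp (- \<Lambda> s) r)\<close> follows the deterministic flow of \<open>r\<close>, so that its time
derivative matches the radial drift of the generator.
\<close>

lemma transition_integral_coherence:
  fixes P :: "real \<Rightarrow> amplitudes \<Rightarrow> amplitudes measure" and c c' :: complex
    and K K' K'' :: "real \<Rightarrow> real"
  assumes P: "markov_semigroup P"
    and gen: "\<And>f. f \<in> C2c \<Longrightarrow> (f, coupler_gen \<Gamma> \<Lambda> \<Theta> \<nu> f) \<in> inf_generator P"
    and K: "\<And>\<rho>. (K has_field_derivative K' \<rho>) (at \<rho>)"
    and K': "\<And>\<rho>. (K' has_field_derivative K'' \<rho>) (at \<rho>)"
    and K'': "continuous_on UNIV K''"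
    and R: "\<forall>\<rho>\<ge>R. K \<rho> = 0 \<and> K' \<rho> = 0"
    and "t \<ge> 0"
  shows "(\<integral>a. (c + c' * (snd a * cnj (fst a))) * of_real (K ((norm a)\<^sup>2)) \<partial>P t x)
    = (c + of_real (exp (- (\<Gamma> + \<Lambda>) * t)) * c' * (snd x * cnj (fst x)))
      * of_real (K (exp (- \<Lambda> * t) * (norm x)\<^sup>2))"
proof -
  define p where "p s a = c + of_real (exp (- (\<Gamma> + \<Lambda>) * s)) * c' * (snd a * cnj (fst a))"
    for s and a :: amplitudes
  define F where "F s a = p s a * of_real (K (exp (- \<Lambda> * s) * (norm a)\<^sup>2))" for s a
  define G where "G s a = - of_real (\<Gamma> + \<Lambda>) * (of_real (exp (- (\<Gamma> + \<Lambda>) * s)) * c' * (snd a * cnj (fst a)))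
        * of_real (K (exp (- \<Lambda> * s) * (norm a)\<^sup>2))
      - of_real (\<Lambda> * (norm a)\<^sup>2 * (exp (- \<Lambda> * s) * K' (exp (- \<Lambda> * s) * (norm a)\<^sup>2))) * p s a" for s a
  have FG: "(F s, G s) \<in> inf_generator P" for s
  proof -
    define q where "q = exp (- \<Lambda> * s)"
    have "q > 0" by (simp add: q_def)
    have d: "((\<lambda>\<rho>. K (q * \<rho>)) has_field_derivative q * K' (q * \<rho>)) (at \<rho>)" for \<rho>
      using DERIV_chain2[OF K DERIV_cmult_Id, of q \<rho>] by (simp add: mult.commute)
    have d': "((\<lambda>\<rho>. q * K' (q * \<rho>)) has_field_derivative q * (q * K'' (q * \<rho>))) (at \<rho>)" for \<rho>
      using DERIV_cmult[OF DERIV_chain2[OF K' DERIV_cmult_Id, of q \<rho>], of q] by (simp add: mult.commute)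
    have cK: "continuous_on UNIV (\<lambda>\<rho>. q * (q * K'' (q * \<rho>)))"
      by (intro continuous_intros continuous_on_compose2[OF K'']) auto
    have r: "\<forall>\<rho>\<ge>R / q. K (q * \<rho>) = 0"
      using \<open>q > 0\<close> R by (auto simp: field_simps)
    note * = coupler_gen_coherence[OF d d' cK r, where c = c
        and c' = "of_real (exp (- (\<Gamma> + \<Lambda>) * s)) * c'"]
    have "F s \<in> C2c" using *(1) by (simp add: F_def[abs_def] p_def q_def)
    from gen[OF this] have "(F s, coupler_gen \<Gamma> \<Lambda> \<Theta> \<nu> (F s)) \<in> inf_generator P" .
    moreover have "coupler_gen \<Gamma> \<Lambda> \<Theta> \<nu> (F s) = G s"
      using *(2)[where \<Gamma> = \<Gamma> and \<Lambda> = \<Lambda> and \<Theta> = \<Theta> and \<nu> = \<nu>]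
      by (intro ext) (simp add: F_def[abs_def] G_def p_def q_def)
    ultimately show ?thesis by (simp only:)
  qed
  have contK: "continuous_on UNIV K" by (rule DERIV_continuous_on[where D = K']) (rule K)
  have contK': "continuous_on UNIV K'" by (rule DERIV_continuous_on[where D = K'']) (rule K')
  have "uniform_limit UNIV (\<lambda>h a. (F (s + h) a - F s a) / of_real h) (G s) (at 0)" for s
  proof (rule uniform_derivative_of_compact_support)
    fix u and a :: amplitudes
    have e: "((\<lambda>u. exp (m * u)) has_field_derivative m * exp (m * u)) (at u)" for m :: real
      by (auto intro!: derivative_eq_intros)
    have k: "((\<lambda>u. K (exp (- \<Lambda> * u) * (norm a)\<^sup>2)) has_field_derivative
        K' (exp (- \<Lambda> * u) * (norm a)\<^sup>2) * (- \<Lambda> * exp (- \<Lambda> * u) * (norm a)\<^sup>2)) (at u)"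
      by (rule DERIV_chain2[OF K]) (auto intro!: derivative_eq_intros)
    have p: "((\<lambda>u. p u a) has_vector_derivative
        of_real (- (\<Gamma> + \<Lambda>) * exp (- (\<Gamma> + \<Lambda>) * u)) * c' * (snd a * cnj (fst a))) (at u)"
      using has_vector_derivative_add[OF has_vector_derivative_const[of c]
          has_vector_derivative_mult_left[OF has_vector_derivative_mult_left[OF
            has_vector_derivative_of_real[OF e]]]]
      unfolding p_def add_0 .
    have "((\<lambda>u. F u a) has_vector_derivative
        p u a * of_real (K' (exp (- \<Lambda> * u) * (norm a)\<^sup>2) * (- \<Lambda> * exp (- \<Lambda> * u) * (norm a)\<^sup>2))
        + of_real (- (\<Gamma> + \<Lambda>) * exp (- (\<Gamma> + \<Lambda>) * u)) * c' * (snd a * cnj (fst a))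
          * of_real (K (exp (- \<Lambda> * u) * (norm a)\<^sup>2))) (at u)"
      unfolding F_def by (rule has_vector_derivative_mult[OF p has_vector_derivative_of_real[OF k]])
    also have "p u a * of_real (K' (exp (- \<Lambda> * u) * (norm a)\<^sup>2) * (- \<Lambda> * exp (- \<Lambda> * u) * (norm a)\<^sup>2))
        + of_real (- (\<Gamma> + \<Lambda>) * exp (- (\<Gamma> + \<Lambda>) * u)) * c' * (snd a * cnj (fst a))
          * of_real (K (exp (- \<Lambda> * u) * (norm a)\<^sup>2)) = G u a"
      by (simp add: G_def)
    finally show "((\<lambda>u. F u a) has_vector_derivative G u a) (at u)" .
  next
    show "continuous_on UNIV (\<lambda>(u, a). G u a)"
      unfolding G_def p_def split_beta
      by (intro continuous_intros continuous_on_compose2[OF contK] continuous_on_compose2[OF contK']) auto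
  next
    \<comment> \<open>one ball that contains the supports for all times within distance 1 of \<open>s\<close>\<close>
    define Q where "Q = exp (\<bar>\<Lambda>\<bar> * (\<bar>s\<bar> + 1)) * \<bar>R\<bar>"
    show "compact (cball (0::amplitudes) (sqrt Q))" by simp
    fix u :: real and a :: amplitudes
    assume u: "\<bar>u - s\<bar> < 1" and a: "a \<notin> cball 0 (sqrt Q)"
    have "Q \<ge> 0" by (simp add: Q_def)
    have "sqrt Q < norm a" using a by simp
    then have "(sqrt Q)\<^sup>2 < (norm a)\<^sup>2" using \<open>Q \<ge> 0\<close> by (intro power_strict_mono) auto
    then have Qa: "Q < (norm a)\<^sup>2" using \<open>Q \<ge> 0\<close> by simp
    have "\<Lambda> * u \<le> \<bar>\<Lambda>\<bar> * \<bar>u\<bar>" by (metis abs_ge_self abs_mult)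
    also have "\<dots> \<le> \<bar>\<Lambda>\<bar> * (\<bar>s\<bar> + 1)" using u by (intro mult_left_mono) auto
    finally have "1 \<le> exp (- \<Lambda> * u) * exp (\<bar>\<Lambda>\<bar> * (\<bar>s\<bar> + 1))"
      by (simp flip: exp_add)
    then have "1 * \<bar>R\<bar> \<le> exp (- \<Lambda> * u) * exp (\<bar>\<Lambda>\<bar> * (\<bar>s\<bar> + 1)) * \<bar>R\<bar>"
      by (rule mult_right_mono) simp
    then have "\<bar>R\<bar> \<le> exp (- \<Lambda> * u) * Q" by (simp add: Q_def mult.assoc)
    also have "\<dots> \<le> exp (- \<Lambda> * u) * (norm a)\<^sup>2" using Qa by (intro mult_left_mono) auto
    finally have "R \<le> exp (- \<Lambda> * u) * (norm a)\<^sup>2" by simp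
    then show "G u a = 0" using R by (simp add: G_def)
  qed
  then have "(\<integral>a. F 0 a \<partial>P t x) = F t x"
    using FG \<open>t \<ge> 0\<close> by (intro backward_equation_solution[OF P, of F G]) auto
  then show ?thesis by (simp add: F_def p_def)
qed

lemma has_field_derivative_positive_part_power:
  "((\<lambda>x::real. (max 0 x) ^ Suc (Suc n)) has_field_derivative of_nat (Suc (Suc n)) * (max 0 x) ^ Suc n) (at x)"
proof -
  consider "x > 0" | "x < 0" | "x = 0" by linarith
  then show ?thesis
  proof cases
    case 1
    have "((\<lambda>x::real. x ^ Suc (Suc n)) has_field_derivative of_nat (Suc (Suc n)) * x ^ Suc n) (at x)"
      using DERIV_pow[of "Suc (Suc n)" x UNIV] by simp
    from has_field_derivative_transform_within_open[OF this, of "{0<..}"] 1 show ?thesis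
      by (simp add: max_def)
  next
    case 2
    have "((\<lambda>x::real. 0) has_field_derivative 0) (at x)" by simp
    from has_field_derivative_transform_within_open[OF this, of "{..<0}"] 2 show ?thesis
      by (simp add: max_def)
  next
    case 3
    have "((\<lambda>h::real. (max 0 h) ^ Suc (Suc n) / h) \<longlongrightarrow> 0) (at 0)"
    proof (rule Lim_null_comparison)
      show "\<forall>\<^sub>F h in at 0. norm ((max 0 h) ^ Suc (Suc n) / h) \<le> \<bar>h\<bar> ^ Suc n"
        by (rule always_eventually) (auto simp: max_def abs_mult power_abs mult_nonpos_nonneg)
      show "((\<lambda>h::real. \<bar>h\<bar> ^ Suc n) \<longlongrightarrow> 0) (at 0)" by (auto intro!: tendsto_eq_intros)
    qed
    then show ?thesis using 3 by (simp add: DERIV_def)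
  qed
qed

text \<open>The cube of the positive part is the least integer power that is \<open>C\<^sup>2\<close>.\<close>

definition bump :: "real \<Rightarrow> real \<Rightarrow> real" where
  "bump m \<rho> = (max 0 (1 - (\<rho> - m)\<^sup>2)) ^ 3"

lemma bump_bounds: "0 \<le> bump m \<rho>" "bump m \<rho> \<le> 1" "bump m \<rho> = 1 \<longleftrightarrow> \<rho> = m"
proof -
  let ?b = "max 0 (1 - (\<rho> - m)\<^sup>2)"
  have b: "0 \<le> ?b" "?b \<le> 1" by auto
  show "0 \<le> bump m \<rho>" unfolding bump_def by simp
  show "bump m \<rho> \<le> 1" unfolding bump_def using b power_le_one by blast
  have "bump m \<rho> = 1 \<longleftrightarrow> ?b = 1"
    unfolding bump_def using power_eq_iff_eq_base[of 3 ?b 1] b(1) by simp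
  also have "\<dots> \<longleftrightarrow> \<rho> = m" by (auto simp: max_def)
  finally show "bump m \<rho> = 1 \<longleftrightarrow> \<rho> = m" .
qed

lemma bump_C2:
  obtains K' K'' where "\<And>\<rho>. (bump m has_field_derivative K' \<rho>) (at \<rho>)"
    "\<And>\<rho>. (K' has_field_derivative K'' \<rho>) (at \<rho>)" "continuous_on UNIV K''"
    "\<forall>\<rho>\<ge>m + 1. bump m \<rho> = 0 \<and> K' \<rho> = 0"
proof
  let ?b = "\<lambda>\<rho>. max 0 (1 - (\<rho> - m)\<^sup>2)"
  let ?K' = "\<lambda>\<rho>. 3 * (?b \<rho>)\<^sup>2 * (- 2 * (\<rho> - m))"
  let ?K'' = "\<lambda>\<rho>. 3 * (2 * ?b \<rho> * (- 2 * (\<rho> - m))) * (- 2 * (\<rho> - m)) + 3 * (?b \<rho>)\<^sup>2 * (- 2)"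
  have i: "((\<lambda>\<rho>. 1 - (\<rho> - m)\<^sup>2) has_field_derivative - 2 * (\<rho> - m)) (at \<rho>)" for \<rho>
    by (auto intro!: derivative_eq_intros)
  have b3: "((\<lambda>\<rho>. (?b \<rho>) ^ 3) has_field_derivative ?K' \<rho>) (at \<rho>)" for \<rho>
    using DERIV_chain2[OF has_field_derivative_positive_part_power[of 1] i, of \<rho>]
    by (simp add: eval_nat_numeral)
  show "(bump m has_field_derivative ?K' \<rho>) (at \<rho>)" for \<rho>
    using b3 by (simp add: bump_def[abs_def])
  have b2: "((\<lambda>\<rho>. (?b \<rho>)\<^sup>2) has_field_derivative 2 * ?b \<rho> * (- 2 * (\<rho> - m))) (at \<rho>)" for \<rho>
    using DERIV_chain2[OF has_field_derivative_positive_part_power[of 0] i, of \<rho>]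
    by (simp add: eval_nat_numeral)
  show "(?K' has_field_derivative ?K'' \<rho>) (at \<rho>)" for \<rho>
    by (rule derivative_eq_intros b2 refl)+ (simp add: algebra_simps)
  show "continuous_on UNIV ?K''" by (intro continuous_intros)
  have "?b \<rho> = 0" if "\<rho> \<ge> m + 1" for \<rho>
  proof -
    have "1\<^sup>2 \<le> (\<rho> - m)\<^sup>2" using that by (intro power_mono) auto
    then show ?thesis by simp
  qed
  then show "\<forall>\<rho>\<ge>m + 1. bump m \<rho> = 0 \<and> ?K' \<rho> = 0" by (simp add: bump_def)
qed

lemma borel_measurable_amplitudes:
  "(\<lambda>a::amplitudes. bump m ((norm a)\<^sup>2)) \<in> borel_measurable borel"
  "(\<lambda>a::amplitudes. (norm a)\<^sup>2) \<in> borel_measurable borel"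
  "(\<lambda>a::amplitudes. snd a * cnj (fst a)) \<in> borel_measurable borel"
  unfolding bump_def by (intro borel_measurable_continuous_onI continuous_intros)+

context
  fixes P :: "real \<Rightarrow> amplitudes \<Rightarrow> amplitudes measure" and \<Gamma> \<Lambda> \<Theta> \<nu> :: real
  assumes P: "markov_semigroup P"
    and gen: "\<And>f. f \<in> C2c \<Longrightarrow> (f, coupler_gen \<Gamma> \<Lambda> \<Theta> \<nu> f) \<in> inf_generator P"
begin

lemma transition_integral_bump:
  assumes "t \<ge> 0" and "m = exp (- \<Lambda> * t) * (norm x)\<^sup>2"
  shows "(\<integral>a. (c + c' * (snd a * cnj (fst a))) * of_real (bump m ((norm a)\<^sup>2)) \<partial>P t x)
    = c + of_real (exp (- (\<Gamma> + \<Lambda>) * t)) * c' * (snd x * cnj (fst x))"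
proof -
  obtain K' K'' where K: "\<And>\<rho>. (bump m has_field_derivative K' \<rho>) (at \<rho>)"
    "\<And>\<rho>. (K' has_field_derivative K'' \<rho>) (at \<rho>)" "continuous_on UNIV K''"
    "\<forall>\<rho>\<ge>m + 1. bump m \<rho> = 0 \<and> K' \<rho> = 0"
    using bump_C2[of m] by blast
  show ?thesis
    using transition_integral_coherence[OF P gen K \<open>t \<ge> 0\<close>, where c = c and c' = c' and x = x] bump_bounds(3)[of m m]
    unfolding assms(2)[symmetric] by simp
qed

text \<open>A function with values in \<open>[0, 1]\<close> and mean 1 equals 1 almost surely.\<close>

lemma AE_transition_power:
  assumes t: "t \<ge> 0"
  shows "AE a in P t x. (norm a)\<^sup>2 = exp (- \<Lambda> * t) * (norm x)\<^sup>2"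
proof -
  interpret prob_space "P t x" by (rule kernel_prob_space[OF P t])
  define m where "m = exp (- \<Lambda> * t) * (norm x)\<^sup>2"
  have int: "integrable (P t x) (\<lambda>a. bump m ((norm a)\<^sup>2))"
    using borel_measurable_amplitudes bump_bounds[of m]
    by (intro kernel_integrable[OF P t, where B = 1]) auto
  have "of_real (\<integral>a. bump m ((norm a)\<^sup>2) \<partial>P t x) = (1::complex)"
    using transition_integral_bump[OF t m_def, of 1 0] by simp
  then have "(\<integral>a. 1 - bump m ((norm a)\<^sup>2) \<partial>P t x) = 0"
    using int by (simp add: prob_space)
  then have "AE a in P t x. 1 - bump m ((norm a)\<^sup>2) = 0"
    using int bump_bounds(2)[of m] by (subst (asm) integral_nonneg_eq_0_iff_AE) auto
  then show ?thesis
    by eventually_elim (use bump_bounds(3)[of m] in \<open>simp add: m_def\<close>)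
qed

text \<open>On the sphere that carries \<open>P\<^sub>t(x, \<cdot>)\<close> the coherence is bounded and the bump equals 1.\<close>

lemma transition_coherence:
  assumes t: "t \<ge> 0"
  shows "integrable (P t x) (\<lambda>a. snd a * cnj (fst a))"
    and "(\<integral>a. snd a * cnj (fst a) \<partial>P t x) = of_real (exp (- (\<Gamma> + \<Lambda>) * t)) * (snd x * cnj (fst x))"
proof -
  interpret prob_space "P t x" by (rule kernel_prob_space[OF P t])
  define m where "m = exp (- \<Lambda> * t) * (norm x)\<^sup>2"
  note meas = borel_measurable_amplitudes[unfolded measurable_cong_sets[OF kernel_sets[OF P t, of x] refl, symmetric]]
  have power: "AE a in P t x. (norm a)\<^sup>2 = m"
    using AE_transition_power[OF t] by (simp add: m_def)
  have le: "norm (snd a * cnj (fst a)) \<le> (norm a)\<^sup>2" for a :: amplitudes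
  proof -
    have "norm (snd a * cnj (fst a)) \<le> norm a * norm a"
      unfolding norm_mult complex_mod_cnj using norm_fst_le[of "fst a" "snd a"] norm_snd_le[of "snd a" "fst a"]
      by (intro mult_mono) auto
    then show ?thesis by (simp add: power2_eq_square)
  qed
  have "AE a in P t x. norm (snd a * cnj (fst a)) \<le> m"
    using power by eventually_elim (use le in force)
  then show "integrable (P t x) (\<lambda>a. snd a * cnj (fst a))"
    using meas(3) by (rule integrable_const_bound)
  have "AE a in P t x. snd a * cnj (fst a)
      = (0 + 1 * (snd a * cnj (fst a))) * of_real (bump m ((norm a)\<^sup>2))"
    using power by eventually_elim (use bump_bounds(3)[of m m] in simp)
  then have "(\<integral>a. snd a * cnj (fst a) \<partial>P t x)
      = (\<integral>a. (0 + 1 * (snd a * cnj (fst a))) * of_real (bump m ((norm a)\<^sup>2)) \<partial>P t x)"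
    using meas by (intro integral_cong_AE) auto
  also have "\<dots> = of_real (exp (- (\<Gamma> + \<Lambda>) * t)) * (snd x * cnj (fst x))"
    using transition_integral_bump[OF t m_def, of 0 1] by simp
  finally show "(\<integral>a. snd a * cnj (fst a) \<partial>P t x)
      = of_real (exp (- (\<Gamma> + \<Lambda>) * t)) * (snd x * cnj (fst x))" .
qed

end

section \<open>The process and the power imbalance\<close>

text \<open>Taking means in the Markov property at time \<open>0\<close> yields the one-dimensional marginals.\<close>

lemma markov_process_distr:
  assumes X: "markov_process M X P" and start: "AE \<omega> in M. X 0 \<omega> = x" and "t \<ge> 0"
  shows "distr M borel (X t) = P t x"
proof (rule measure_eqI)
  interpret prob_space M using X by (simp add: markov_process_def)
  have P: "markov_semigroup P" and Xm: "\<And>t. t \<ge> 0 \<Longrightarrow> X t \<in> M \<rightarrow>\<^sub>M borel"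
    using X by (auto simp: markov_process_def)
  note [measurable] = Xm[OF \<open>t \<ge> 0\<close>]
  interpret Pt: prob_space "P t x" by (rule kernel_prob_space[OF P \<open>t \<ge> 0\<close>])
  show "sets (distr M borel (X t)) = sets (P t x)"
    using kernel_sets[OF P \<open>t \<ge> 0\<close>] by simp
  fix A assume "A \<in> sets (distr M borel (X t))"
  then have A: "A \<in> sets borel" by simp
  define S where "S = {X u -` B \<inter> space M | u B. 0 \<le> u \<and> u \<le> (0::real) \<and> B \<in> sets borel}"
  have "S \<subseteq> sets M" using Xm[of 0] by (auto simp: S_def intro: measurable_sets)
  then have "sigma_sets (space M) S \<subseteq> sets M" by (rule sets.sigma_sets_subset)
  moreover have "S \<subseteq> Pow (space M)" by (auto simp: S_def)
  ultimately have "subalgebra M (natural_filtration M X 0)"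
    by (simp add: subalgebra_def natural_filtration_def flip: S_def)
  then interpret finite_measure_subalgebra M "natural_filtration M X 0" by unfold_locales
  have ind: "integrable M (\<lambda>\<omega>. indicator A (X t \<omega>) :: real)"
    using A by (intro integrable_const_bound[where B = 1]) auto
  have "\<forall>s\<ge>0. \<forall>t\<ge>0. \<forall>A\<in>sets borel. AE \<omega> in M.
      real_cond_exp M (natural_filtration M X s) (\<lambda>\<omega>. indicator A (X (s + t) \<omega>)) \<omega>
        = measure (P t (X s \<omega>)) A"
    using X by (simp add: markov_process_def)
  from this[rule_format, of 0 t A]
  have "AE \<omega> in M. real_cond_exp M (natural_filtration M X 0) (\<lambda>\<omega>. indicator A (X t \<omega>)) \<omega>
      = measure (P t (X 0 \<omega>)) A"
    using A \<open>t \<ge> 0\<close> by simp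
  then have "AE \<omega> in M. real_cond_exp M (natural_filtration M X 0) (\<lambda>\<omega>. indicator A (X t \<omega>)) \<omega>
      = measure (P t x) A" using start by eventually_elim simp
  then have "(\<integral>\<omega>. real_cond_exp M (natural_filtration M X 0) (\<lambda>\<omega>. indicator A (X t \<omega>)) \<omega> \<partial>M)
      = (\<integral>\<omega>. measure (P t x) A \<partial>M)"
    by (intro integral_cong_AE) auto
  then have "(\<integral>\<omega>. indicator A (X t \<omega>) \<partial>M) = measure (P t x) A"
    using real_cond_exp_int(2)[OF ind] by (simp add: prob_space)
  moreover have "(\<integral>\<omega>. indicator A (X t \<omega>) \<partial>M) = measure (distr M borel (X t)) A"
    using A by (simp add: integral_distr[symmetric, where N = borel and f = "indicator A"])
  moreover have "prob_space (distr M borel (X t))" by (rule prob_space_distr) simp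
  then interpret D: prob_space "distr M borel (X t)" .
  show "emeasure (distr M borel (X t)) A = emeasure (P t x) A"
    using calculation by (simp add: D.emeasure_eq_measure Pt.emeasure_eq_measure)
qed

lemma Re_of_real_mult: "Re (of_real r * w) = r * Re w"
  by simp

lemma cmod_add_diff_unimodular:
  fixes x y :: complex and p q :: real
  defines "u \<equiv> x * exp (\<i> * of_real p)" and "v \<equiv> y * exp (\<i> * of_real q)"
  shows "(cmod (u + v))\<^sup>2 + (cmod (u - v))\<^sup>2 = 2 * ((cmod x)\<^sup>2 + (cmod y)\<^sup>2)"
    and "(cmod (u + v))\<^sup>2 - (cmod (u - v))\<^sup>2 = 4 * Re (x * cnj y * exp (\<i> * of_real (p - q)))"
proof -
  have n: "cmod u = cmod x" "cmod v = cmod y" by (simp_all add: u_def v_def norm_mult)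
  have "(cmod (u + v))\<^sup>2 + (cmod (u - v))\<^sup>2 = 2 * ((cmod u)\<^sup>2 + (cmod v)\<^sup>2)"
    unfolding cmod_power2 by (simp add: power2_eq_square algebra_simps)
  then show "(cmod (u + v))\<^sup>2 + (cmod (u - v))\<^sup>2 = 2 * ((cmod x)\<^sup>2 + (cmod y)\<^sup>2)" by (simp add: n)
  have "exp (\<i> * of_real (p - q)) = exp (\<i> * of_real p) * cnj (exp (\<i> * of_real q))"
    by (simp add: exp_cnj right_diff_distrib exp_diff exp_minus field_simps)
  then have "x * cnj y * exp (\<i> * of_real (p - q)) = u * cnj v" by (simp add: u_def v_def)
  moreover have "(cmod (u + v))\<^sup>2 - (cmod (u - v))\<^sup>2 = 4 * Re (u * cnj v)"
    unfolding cmod_power2 by (simp add: power2_eq_square algebra_simps)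
  ultimately show "(cmod (u + v))\<^sup>2 - (cmod (u - v))\<^sup>2 = 4 * Re (x * cnj y * exp (\<i> * of_real (p - q)))"
    by simp
qed

text \<open>
The common wavenumber \<open>\<beta>\<close> drops out of the beat \<open>a\<^sub>e cnj a\<^sub>o\<close>, which leaves the difference
\<open>\<beta>e - \<beta>o\<close> in the phase.
\<close>

lemma power_imbalance_eq:
  "(cmod (u_plus \<beta>e \<beta>o \<beta> \<epsilon> z a))\<^sup>2 + (cmod (u_minus \<beta>e \<beta>o \<beta> \<epsilon> z a))\<^sup>2 = 2 * (norm a)\<^sup>2"
  "power_imbalance \<beta>e \<beta>o \<beta> \<epsilon> z a
    = 2 * Re (cnj (snd a * cnj (fst a)) * exp (\<i> * of_real ((\<beta>e - \<beta>o) * z / \<epsilon>\<^sup>2))) / (norm a)\<^sup>2"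
proof -
  note * = cmod_add_diff_unimodular[of "fst a" "(\<beta>e - \<beta>) * z / \<epsilon>\<^sup>2" "snd a" "(\<beta>o - \<beta>) * z / \<epsilon>\<^sup>2"]
  have n: "(cmod (fst a))\<^sup>2 + (cmod (snd a))\<^sup>2 = (norm a)\<^sup>2" by (simp add: norm_prod_def)
  show s: "(cmod (u_plus \<beta>e \<beta>o \<beta> \<epsilon> z a))\<^sup>2 + (cmod (u_minus \<beta>e \<beta>o \<beta> \<epsilon> z a))\<^sup>2 = 2 * (norm a)\<^sup>2"
    using *(1) by (simp add: u_plus_def u_minus_def n)
  have "(\<beta>e - \<beta>) * z / \<epsilon>\<^sup>2 - (\<beta>o - \<beta>) * z / \<epsilon>\<^sup>2 = (\<beta>e - \<beta>o) * z / \<epsilon>\<^sup>2"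
    by (simp add: algebra_simps flip: diff_divide_distrib)
  with *(2) have "(cmod (u_plus \<beta>e \<beta>o \<beta> \<epsilon> z a))\<^sup>2 - (cmod (u_minus \<beta>e \<beta>o \<beta> \<epsilon> z a))\<^sup>2
      = 4 * Re (cnj (snd a * cnj (fst a)) * exp (\<i> * of_real ((\<beta>e - \<beta>o) * z / \<epsilon>\<^sup>2)))"
    unfolding u_plus_def u_minus_def by (simp only: amp.simps complex_cnj_mult complex_cnj_cnj mult.commute)
  moreover have "4 * w / (2 * c) = 2 * w / c" for w c :: real by simp
  ultimately show "power_imbalance \<beta>e \<beta>o \<beta> \<epsilon> z a
    = 2 * Re (cnj (snd a * cnj (fst a)) * exp (\<i> * of_real ((\<beta>e - \<beta>o) * z / \<epsilon>\<^sup>2))) / (norm a)\<^sup>2"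
    unfolding power_imbalance_def s by (simp only:)
qed

theorem mainTheorem6:
  fixes k n D d \<epsilon> \<beta> \<beta>e \<beta>o \<Gamma> \<Lambda> \<Theta> \<kappa> \<kappa>ev :: real
    and R :: "real \<Rightarrow> real"
    and N :: "'v measure" and V :: "real \<Rightarrow> 'v \<Rightarrow> real"
    and M :: "'w measure" and X :: "real \<Rightarrow> 'w \<Rightarrow> complex \<times> complex"
    and ae ao :: "real \<Rightarrow> 'w \<Rightarrow> complex"
    and ae0 ao0 :: complex
  assumes "k > 0" "n > 1" "D > 0" "d > 0" "\<epsilon> > 0"
    and "k * D * sqrt (n\<^sup>2 - 1) < pi"
    and "single_guide_wavenumber k n D \<beta>"
    and "even_wavenumber k n d D \<beta>e"
    and "odd_wavenumber k n d D \<beta>o"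
    and "stationary_with_covariance N V R"
    and "smooth_fun R" and "integrable lborel R" and "\<forall>q. spectrum R q \<ge> 0"
    and "\<Gamma> = Gamma_coef k n D \<beta> R"
    and "\<Lambda> = Lambda_coef k n D \<beta> R"
    and "\<Theta> = Theta_coef k n D \<beta> R"
    and "\<kappa> = kappa_coef k n D \<beta> R"
    and "\<kappa>ev = kappa_ev k n D \<beta> R"
    and "(ae0, ao0) \<noteq> (0, 0)"
    and "markov_process_generated_by M X (coupler_gen \<Gamma> \<Lambda> \<Theta> (\<kappa> + \<kappa>ev)) (ae0, ao0)"
    and "\<And>z \<omega>. ae z \<omega> = fst (X z \<omega>)" and "\<And>z \<omega>. ao z \<omega> = snd (X z \<omega>)"
  shows "\<forall>z\<ge>0.
     (AE \<omega> in M.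
        (cmod (ae z \<omega>))\<^sup>2 + (cmod (ao z \<omega>))\<^sup>2
          = ((cmod ae0)\<^sup>2 + (cmod ao0)\<^sup>2) * exp (- \<Lambda> * z)
      \<and> (cmod (u_plus \<beta>e \<beta>o \<beta> \<epsilon> z (X z \<omega>)))\<^sup>2 + (cmod (u_minus \<beta>e \<beta>o \<beta> \<epsilon> z (X z \<omega>)))\<^sup>2
          = 2 * ((cmod (ae z \<omega>))\<^sup>2 + (cmod (ao z \<omega>))\<^sup>2)
      \<and> (cmod (u_plus \<beta>e \<beta>o \<beta> \<epsilon> z (X z \<omega>)))\<^sup>2 + (cmod (u_minus \<beta>e \<beta>o \<beta> \<epsilon> z (X z \<omega>)))\<^sup>2
          = 2 * ((cmod ae0)\<^sup>2 + (cmod ao0)\<^sup>2) * exp (- \<Lambda> * z))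
   \<and> (integrable M (\<lambda>\<omega>. ao z \<omega> * cnj (ae z \<omega>))
      \<and> (\<integral>\<omega>. ao z \<omega> * cnj (ae z \<omega>) \<partial>M) = ao0 * cnj ae0 * of_real (exp (- (\<Gamma> + \<Lambda>) * z)))
   \<and> (integrable M (\<lambda>\<omega>. power_imbalance \<beta>e \<beta>o \<beta> \<epsilon> z (X z \<omega>))
      \<and> (\<integral>\<omega>. power_imbalance \<beta>e \<beta>o \<beta> \<epsilon> z (X z \<omega>) \<partial>M)
          = 2 * Re (ae0 * cnj ao0 * exp (\<i> * of_real ((\<beta>e - \<beta>o) * z / \<epsilon>\<^sup>2)))
              / ((cmod ae0)\<^sup>2 + (cmod ao0)\<^sup>2) * exp (- \<Gamma> * z))"
  (is "\<forall>z\<ge>0. ?claim z")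
proof (intro allI impI)
  fix z :: real assume z: "z \<ge> 0"
  let ?x = "(ae0, ao0)"
  obtain P where X: "markov_process M X P"
    and gen: "\<And>f. f \<in> C2c \<Longrightarrow> (f, coupler_gen \<Gamma> \<Lambda> \<Theta> (\<kappa> + \<kappa>ev) f) \<in> inf_generator P"
    and start: "AE \<omega> in M. X 0 \<omega> = ?x"
    using assms(20) unfolding markov_process_generated_by_def by blast
  have P: "markov_semigroup P" and Xm [measurable]: "X z \<in> M \<rightarrow>\<^sub>M borel"
    using X z by (auto simp: markov_process_def)
  note law = markov_process_distr[OF X start z]
  define q where "q = (\<lambda>a::amplitudes. snd a * cnj (fst a))"
  have q_app: "snd a * cnj (fst a) = q a" for a by (simp add: q_def)
  have qx: "q ?x = ao0 * cnj ae0" by (simp add: q_def)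
  define e where "e = exp (\<i> * complex_of_real ((\<beta>e - \<beta>o) * z / \<epsilon>\<^sup>2))"
  define r where "r = (cmod ae0)\<^sup>2 + (cmod ao0)\<^sup>2"
  have norm2: "(norm a)\<^sup>2 = (cmod (fst a))\<^sup>2 + (cmod (snd a))\<^sup>2" for a :: amplitudes
    by (simp add: norm_prod_def)
  have r: "(norm ?x)\<^sup>2 = r" "r > 0"
  proof -
    show "(norm ?x)\<^sup>2 = r" by (simp add: norm2 r_def)
    then show "r > 0" using assms(19) by (metis zero_prod_def zero_less_norm_iff zero_less_power)
  qed
  have power: "AE \<omega> in M. (norm (X z \<omega>))\<^sup>2 = r * exp (- \<Lambda> * z)"
    using AE_transition_power[OF P gen z, of ?x] AE_distrD[OF Xm] unfolding law[symmetric] r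
    by (simp add: mult.commute)
  have qm [measurable]: "q \<in> borel_measurable borel"
    unfolding q_def by (rule borel_measurable_amplitudes)
  have q: "integrable M (\<lambda>\<omega>. q (X z \<omega>))"
    "(\<integral>\<omega>. q (X z \<omega>) \<partial>M) = ao0 * cnj ae0 * of_real (exp (- (\<Gamma> + \<Lambda>) * z))"
    using transition_coherence[OF P gen z, of ?x] integral_distr[OF Xm qm] integrable_distr_eq[OF Xm qm]
    unfolding law[symmetric] q_app by (simp_all add: qx mult.commute)
  \<comment> \<open>the imbalance with its random denominator replaced by the almost sure value\<close>
  define g where "g \<omega> = 2 * Re (cnj (q (X z \<omega>)) * e) / (r * exp (- \<Lambda> * z))" for \<omega>
  have g: "integrable M g" unfolding g_def[abs_def] using q(1) by simp
  have imb: "AE \<omega> in M. power_imbalance \<beta>e \<beta>o \<beta> \<epsilon> z (X z \<omega>) = g \<omega>"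
    using power by eventually_elim (simp add: power_imbalance_eq(2) g_def q_def e_def)
  have imb_meas: "(\<lambda>\<omega>. power_imbalance \<beta>e \<beta>o \<beta> \<epsilon> z (X z \<omega>)) \<in> borel_measurable M"
  proof -
    have "integrable M (\<lambda>\<omega>. 2 * Re (cnj (q (X z \<omega>)) * e))" using q(1) by simp
    moreover have "(\<lambda>\<omega>. (norm (X z \<omega>))\<^sup>2) \<in> borel_measurable M"
      by (rule measurable_compose[OF Xm borel_measurable_amplitudes(2)])
    ultimately show ?thesis unfolding power_imbalance_eq(2) q_app e_def[symmetric]
      by (intro borel_measurable_divide) (rule borel_measurable_integrable)
  qed
  have "(\<integral>\<omega>. g \<omega> \<partial>M) = 2 * Re (cnj (\<integral>\<omega>. q (X z \<omega>) \<partial>M) * e) / (r * exp (- \<Lambda> * z))"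
    unfolding g_def[abs_def] using q(1) by simp
  also have "\<dots> = 2 * Re (of_real (exp (- (\<Gamma> + \<Lambda>) * z)) * (ae0 * cnj ao0 * e)) / (r * exp (- \<Lambda> * z))"
    unfolding q(2) by (simp add: mult_ac)
  also have "\<dots> = 2 * Re (ae0 * cnj ao0 * e) / r * (exp (- (\<Gamma> + \<Lambda>) * z) / exp (- \<Lambda> * z))"
  proof -
    have "2 * (a * b) / (r * c) = 2 * b / r * (a / c)" for a b c :: real by simp
    then show ?thesis unfolding Re_of_real_mult .
  qed
  also have "exp (- (\<Gamma> + \<Lambda>) * z) / exp (- \<Lambda> * z) = exp (- \<Gamma> * z)"
    by (simp add: algebra_simps flip: exp_diff)
  finally have int_g: "(\<integral>\<omega>. g \<omega> \<partial>M) = 2 * Re (ae0 * cnj ao0 * e) / r * exp (- \<Gamma> * z)" .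
  have "AE \<omega> in M. (cmod (ae z \<omega>))\<^sup>2 + (cmod (ao z \<omega>))\<^sup>2 = r * exp (- \<Lambda> * z)
      \<and> (cmod (u_plus \<beta>e \<beta>o \<beta> \<epsilon> z (X z \<omega>)))\<^sup>2 + (cmod (u_minus \<beta>e \<beta>o \<beta> \<epsilon> z (X z \<omega>)))\<^sup>2
          = 2 * ((cmod (ae z \<omega>))\<^sup>2 + (cmod (ao z \<omega>))\<^sup>2)
      \<and> (cmod (u_plus \<beta>e \<beta>o \<beta> \<epsilon> z (X z \<omega>)))\<^sup>2 + (cmod (u_minus \<beta>e \<beta>o \<beta> \<epsilon> z (X z \<omega>)))\<^sup>2
          = 2 * r * exp (- \<Lambda> * z)"
    using power by eventually_elim (simp add: power_imbalance_eq(1) assms(21,22) flip: norm2)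
  moreover have "ao z \<omega> * cnj (ae z \<omega>) = q (X z \<omega>)" for \<omega>
    by (simp add: assms(21,22) q_def)
  moreover have "integrable M (\<lambda>\<omega>. power_imbalance \<beta>e \<beta>o \<beta> \<epsilon> z (X z \<omega>))"
    using g imb imb_meas by (subst integrable_cong_AE[where g = g]) auto
  moreover have "(\<integral>\<omega>. power_imbalance \<beta>e \<beta>o \<beta> \<epsilon> z (X z \<omega>) \<partial>M) = (\<integral>\<omega>. g \<omega> \<partial>M)"
    using g imb imb_meas by (intro integral_cong_AE) auto
  ultimately show "?claim z"
    using q int_g unfolding r_def e_def by (simp only: simp_thms)
qed

end
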